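(* Let $n\ge 1$, let $g:[0,1)\to\mathbb{R}$ be continuous with $g(0)=0$, and let $\mu$ be a Borel measure on the open unit ball $\mathbb{B}^n$ with compact support in $\mathbb{B}^n$ and $0<\mu(\mathbb{B}^n)<\infty$. Let $V(x)=\int_{\mathbb{B}^n} v(T_x(y))\,d\mu(y)$ for $x\in\mathbb{B}^n$, with $v$ and $T_x$ as in the context. (a) [Existence] If $\int_0^1 g(r)(1-r^2)^{-1}\,dr=\infty$, then $V(x_c)=0$ for some $x_c\in\mathbb{B}^n$. (b) [Uniqueness] If either (i) $g$ is strictly increasing, or (ii) $g$ is increasing, $g(r)>0$ whenever $0<r<1$, and $\mu$ is not supported in a hyperbolic geodesic, then the point $x_c\in\mathbb{B}^n$ with $V(x_c)=0$ is unique (i.e. $V$ has exactly one zero in $\mathbb{B}^n$; denote it $x_c(\mu)$). (c) [Continuous dependence] Suppose $\mu_k\to\mu$ weakly as $k\to\infty$, where the $\mu_k$ are Borel measures all supported in a fixed compact subset of $\mathbb{B}^n$ and satisfying $0<\mu_k(\mathbb{B}^n)<\infty$. If either (i) holds, or else (ii) holds for $\mu$ and for each $\mu_k$ (that is, (ii) holds as stated and also with $\mu$ replaced by $\mu_k$ for every $k$), then $x_c(\mu_k)\to x_c(\mu)$ as $k\to\infty$.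
   Context: $\mathbb{B}^n$ is the open unit ball centered at the origin in $\mathbb{R}^n$, $\overline{\mathbb{B}^n}$ its closure, and $|\cdot|$ is the euclidean norm. For $x\in\mathbb{B}^n$ the M\"obius transformation $T_x:\overline{\mathbb{B}^n}\to\overline{\mathbb{B}^n}$ is $$T_x(y)=\frac{(1+2x\cdot y+|y|^2)x+(1-|x|^2)y}{1+2x\cdot y+|x|^2|y|^2},\qquad y\in\overline{\mathbb{B}^n}.$$ The radial vector field $v:\mathbb{B}^n\to\mathbb{R}^n$ is $v(y)=g(|y|)\,y/|y|$ for $y\neq 0$ and $v(0)=0$. The condition $\int_0^1 g(r)(1-r^2)^{-1}\,dr=\infty$ means $\int_0^\rho g(r)(1-r^2)^{-1}\,dr\to\infty$ as $\rho\to1^-$. "Increasing" means non-strictly increasing (nondecreasing). Hyperbolic geodesics in $\mathbb{B}^n$ are the (complete) curves that are either straight-line diameters through the origin, or arcs in $\mathbb{B}^n$ of circles meeting the unit sphere at right angles (when $n=1$ the only geodesic is $(-1,1)$). "$\mu$ is not supported in a hyperbolic geodesic" means $\mu(\mathbb{B}^n\setminus\gamma)>0$ for every hyperbolic geodesic $\gamma$. Weak convergence $\mu_k\to\mu$ means $\int\psi\,d\mu_k\to\int\psi\,d\mu$ for every bounded continuous real function $\psi$ on $\mathbb{B}^n$. *)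

theory Defs
  imports "HOL-Analysis.Analysis"
begin

definition moebius :: "real ^ 'n \<Rightarrow> real ^ 'n \<Rightarrow> real ^ 'n" where
  "moebius x y =
     ((1 + 2 * (x \<bullet> y) + (norm y)\<^sup>2) *\<^sub>R x + (1 - (norm x)\<^sup>2) *\<^sub>R y)
       /\<^sub>R (1 + 2 * (x \<bullet> y) + (norm x)\<^sup>2 * (norm y)\<^sup>2)"

definition radial_field :: "(real \<Rightarrow> real) \<Rightarrow> real ^ 'n \<Rightarrow> real ^ 'n" where
  "radial_field g y = (if y = 0 then 0 else g (norm y) *\<^sub>R (y /\<^sub>R norm y))"

definition borel_measure_on_ball :: "(real ^ 'n) measure \<Rightarrow> bool" where
  "borel_measure_on_ball \<mu> \<longleftrightarrow> sets \<mu> = sets (restrict_space borel (ball 0 1))"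

definition supported_in :: "(real ^ 'n) measure \<Rightarrow> (real ^ 'n) set \<Rightarrow> bool" where
  "supported_in \<mu> A \<longleftrightarrow> emeasure \<mu> (ball 0 1 - A) = 0"

definition V_field :: "(real \<Rightarrow> real) \<Rightarrow> (real ^ 'n) measure \<Rightarrow> real ^ 'n \<Rightarrow> real ^ 'n" where
  "V_field g \<mu> x = (\<integral>y. radial_field g (moebius x y) \<partial>\<mu>)"

text \<open>The following is meaningful only when \<^term>\<open>V_field g \<mu>\<close> has exactly one zero in the
  open unit ball.\<close>

definition center_of_mass :: "(real \<Rightarrow> real) \<Rightarrow> (real ^ 'n) measure \<Rightarrow> real ^ 'n" where
  "center_of_mass g \<mu> = (THE x. x \<in> ball 0 1 \<and> V_field g \<mu> x = 0)"

text \<open>A circle with center \<open>c\<close> and radius \<open>r\<close> in the plane through \<open>c\<close> with orthonormal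
  directions \<open>u\<close>, \<open>w\<close>, together with its velocity vector. In dimension one there is no
  orthonormal pair, hence no circle.\<close>

definition circle_path :: "real ^ 'n \<Rightarrow> real \<Rightarrow> real ^ 'n \<Rightarrow> real ^ 'n \<Rightarrow> real \<Rightarrow> real ^ 'n" where
  "circle_path c r u w t = c + r *\<^sub>R (cos t *\<^sub>R u + sin t *\<^sub>R w)"

definition circle_velocity :: "real \<Rightarrow> real ^ 'n \<Rightarrow> real ^ 'n \<Rightarrow> real \<Rightarrow> real ^ 'n" where
  "circle_velocity r u w t = r *\<^sub>R (- sin t *\<^sub>R u + cos t *\<^sub>R w)"

lemma circle_path_has_vector_derivative:
  "(circle_path c r u w has_vector_derivative circle_velocity r u w t) (at t)"
  unfolding circle_path_def circle_velocity_def
  by (auto intro!: derivative_eq_intros simp: algebra_simps)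

text \<open>At a point \<open>p\<close> of the unit sphere, the tangent hyperplane of the sphere consists of the
  vectors orthogonal to \<open>p\<close>; the circle meets the sphere at right angles if it does meet it, and
  at every common point its velocity is orthogonal to that hyperplane.\<close>

definition circle_orthogonal_to_sphere ::
    "real ^ 'n \<Rightarrow> real \<Rightarrow> real ^ 'n \<Rightarrow> real ^ 'n \<Rightarrow> bool" where
  "circle_orthogonal_to_sphere c r u w \<longleftrightarrow>
     (\<exists>t. circle_path c r u w t \<in> sphere 0 1) \<and>
     (\<forall>t. circle_path c r u w t \<in> sphere 0 1 \<longrightarrow>
        (\<forall>h. h \<bullet> circle_path c r u w t = 0 \<longrightarrow> h \<bullet> circle_velocity r u w t = 0))"

definition hyperbolic_geodesic :: "(real ^ 'n) set \<Rightarrow> bool" where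
  "hyperbolic_geodesic \<gamma> \<longleftrightarrow>
     (\<exists>u. norm u = 1 \<and> \<gamma> = {t *\<^sub>R u | t. -1 < t \<and> t < 1}) \<or>
     (\<exists>c r u w. 0 < r \<and> norm u = 1 \<and> norm w = 1 \<and> u \<bullet> w = 0 \<and>
        circle_orthogonal_to_sphere c r u w \<and>
        \<gamma> = range (circle_path c r u w) \<inter> ball 0 1)"

definition not_supported_in_geodesic :: "(real ^ 'n) measure \<Rightarrow> bool" where
  "not_supported_in_geodesic \<mu> \<longleftrightarrow>
     (\<forall>\<gamma>. hyperbolic_geodesic \<gamma> \<longrightarrow> emeasure \<mu> (ball 0 1 - \<gamma>) > 0)"

definition weakly_converges_on_ball ::
    "(nat \<Rightarrow> (real ^ 'n) measure) \<Rightarrow> (real ^ 'n) measure \<Rightarrow> bool" where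
  "weakly_converges_on_ball M \<mu> \<longleftrightarrow>
     (\<forall>\<psi> :: real ^ 'n \<Rightarrow> real.
        continuous_on (ball 0 1) \<psi> \<and> bounded (\<psi> ` ball 0 1) \<longrightarrow>
        (\<lambda>k. \<integral>y. \<psi> y \<partial>(M k)) \<longlonglongrightarrow> (\<integral>y. \<psi> y \<partial>\<mu>))"

end

theory Submission
  imports Defs
begin

text \<open>
  With \<open>G(\<rho>) = \<integral>\<^sub>0\<^sup>\<rho> g(r) / (1 - r\<^sup>2) dr\<close>, the energy \<open>E(x) = \<integral> G(|T\<^sub>x y|) d\<mu>(y)\<close> has gradient
  \<open>V(x) / (1 - |x|\<^sup>2)\<close>. If \<open>G\<close> tends to infinity at \<open>1\<close> then \<open>E\<close> blows up at the unit sphere, hence attains a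
  minimum, where \<open>V\<close> vanishes.

  For uniqueness, suppose that \<open>V\<close> vanishes at \<open>x \<noteq> z\<close>. For each \<open>y\<close> take the hyperbolic triangle with vertices
  \<open>-x\<close>, \<open>-z\<close>, \<open>y\<close>, angles \<open>\<alpha>\<close>, \<open>\<beta>\<close> at the first two, and let \<open>r\<close>, \<open>s\<close> be the norms of \<open>T\<^sub>x y\<close>, \<open>T\<^sub>z y\<close>. Adding the
  components of \<open>V(x)\<close> and \<open>V(z)\<close> along the geodesic that joins the two vertices shows that
  \<open>g(r) cos \<alpha> + g(s) cos \<beta>\<close> has integral \<open>0\<close>. But \<open>cos \<alpha> + cos \<beta> \<ge> 0\<close>, since \<open>\<alpha> + \<beta> \<le> \<pi>\<close>, and a larger side lies
  opposite an obtuse angle, so the integrand is nonnegative; it is positive if \<open>g\<close> is strictly increasing,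
  or if \<open>g > 0\<close> and \<open>y\<close> is off the geodesic through \<open>-x\<close> and \<open>-z\<close>.

  For continuous dependence, \<open>V\<close> points outwards near the unit sphere, uniformly in the measures, so the zeros
  stay in a compact subset of the ball; every limit point is a zero of the limiting field, which is unique.
\<close>

section \<open>Metric identities for Moebius transformations\<close>

definition mden :: "real ^ 'n \<Rightarrow> real ^ 'n \<Rightarrow> real" where
  "mden x y = 1 + 2 * (x \<bullet> y) + (norm x)\<^sup>2 * (norm y)\<^sup>2"

text \<open>\<open>hcosh a b\<close> is the hyperbolic cosine of the hyperbolic distance (curvature \<open>-1\<close>).\<close>

definition hcosh :: "real ^ 'n \<Rightarrow> real ^ 'n \<Rightarrow> real" where
  "hcosh a b = ((1 + (norm a)\<^sup>2) * (1 + (norm b)\<^sup>2) - 4 * (a \<bullet> b)) / ((1 - (norm a)\<^sup>2) * (1 - (norm b)\<^sup>2))"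

lemma norm_sq_less_1:
  fixes x :: "'a::real_normed_vector"
  shows "norm x < 1 \<Longrightarrow> (norm x)\<^sup>2 < 1"
  by (simp add: abs_square_less_1)

text \<open>Cauchy-Schwarz bounds the denominator below by a square. Besides positivity this gives
  \<open>(1 - R)^2\<close> as a lower bound for all \<open>|y| \<le> R\<close> and
  \<open>|x| < 1\<close>, on which coercivity of the energy rests.\<close>

lemma mden_lower: "(1 - norm x * norm y)\<^sup>2 \<le> mden x y"
proof -
  have "- (norm x * norm y) \<le> x \<bullet> y"
    using Cauchy_Schwarz_ineq2[of x y] by linarith
  then show ?thesis
    by (simp add: mden_def power2_eq_square algebra_simps)
qed

lemma mden_pos:
  assumes "norm x < 1" "norm y \<le> 1"
  shows "mden x y > 0"
proof -
  have "norm x * norm y < 1"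
    using assms by (metis mult_left_le norm_ge_zero order_le_less_trans)
  then have "0 < (1 - norm x * norm y)\<^sup>2" by simp
  also have "\<dots> \<le> mden x y" by (rule mden_lower)
  finally show ?thesis .
qed

lemma moebius_mden:
  "moebius x y = ((1 + 2 * (x \<bullet> y) + (norm y)\<^sup>2) *\<^sub>R x + (1 - (norm x)\<^sup>2) *\<^sub>R y) /\<^sub>R mden x y"
  by (simp add: moebius_def mden_def)

lemma moebius_inner_left:
  "moebius x y \<bullet> e = ((1 + 2 * (x \<bullet> y) + (norm y)\<^sup>2) * (x \<bullet> e) + (1 - (norm x)\<^sup>2) * (y \<bullet> e)) / mden x y"
  by (simp add: moebius_mden inner_add_left divide_inverse algebra_simps)

lemma moebius_inner:
  "moebius x y \<bullet> moebius x z =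
   ((1 + 2 * (x \<bullet> y) + (norm y)\<^sup>2) * (1 + 2 * (x \<bullet> z) + (norm z)\<^sup>2) * (norm x)\<^sup>2
    + (1 + 2 * (x \<bullet> y) + (norm y)\<^sup>2) * (1 - (norm x)\<^sup>2) * (x \<bullet> z)
    + (1 + 2 * (x \<bullet> z) + (norm z)\<^sup>2) * (1 - (norm x)\<^sup>2) * (x \<bullet> y)
    + (1 - (norm x)\<^sup>2)\<^sup>2 * (y \<bullet> z)) / (mden x y * mden x z)"
proof -
  have "(a *\<^sub>R x + c *\<^sub>R y) \<bullet> (b *\<^sub>R x + c *\<^sub>R z)
    = a * b * (norm x)\<^sup>2 + a * c * (x \<bullet> z) + b * c * (x \<bullet> y) + c\<^sup>2 * (y \<bullet> z)" for a b c
    by (simp add: inner_add_left inner_add_right dot_square_norm inner_commute[of y] power2_eq_square algebra_simps)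
  then show ?thesis
    by (simp add: moebius_mden divide_inverse mult.commute)
qed

lemma norm_moebius_sq:
  assumes "mden x y \<noteq> 0"
  shows "(norm (moebius x y))\<^sup>2 = ((norm x)\<^sup>2 + 2 * (x \<bullet> y) + (norm y)\<^sup>2) / mden x y"
proof -
  have "(norm (moebius x y))\<^sup>2 = ((norm x)\<^sup>2 + 2 * (x \<bullet> y) + (norm y)\<^sup>2) * mden x y / (mden x y * mden x y)"
    unfolding dot_square_norm[symmetric] moebius_inner
    unfolding dot_square_norm mden_def by (simp add: dot_square_norm power2_eq_square algebra_simps)
  then show ?thesis using assms by simp
qed

lemma one_minus_norm_moebius_sq:
  assumes "mden x y \<noteq> 0"
  shows "1 - (norm (moebius x y))\<^sup>2 = (1 - (norm x)\<^sup>2) * (1 - (norm y)\<^sup>2) / mden x y"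
  unfolding norm_moebius_sq[OF assms] using assms
  by (simp add: field_simps) (simp add: mden_def algebra_simps)

lemma norm_moebius_less_1:
  assumes "norm x < 1" "norm y < 1"
  shows "norm (moebius x y) < 1"
proof -
  have "0 < mden x y" using assms by (auto intro!: mden_pos)
  then have "0 < 1 - (norm (moebius x y))\<^sup>2"
    unfolding one_minus_norm_moebius_sq[OF less_imp_neq[THEN not_sym, OF \<open>0 < mden x y\<close>]]
    using assms norm_sq_less_1 by (intro divide_pos_pos mult_pos_pos) auto
  then show ?thesis by (simp add: abs_square_less_1)
qed

text \<open>The hyperbolic law of cosines at the vertex \<open>-x\<close>, which
  \<open>moebius x\<close> carries to the origin: there angles are Euclidean, and
  \<open>2 r / (1 - r^2)\<close> is the hyperbolic sine of the distance to a point of norm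
  \<open>r\<close>.\<close>

lemma moebius_hcosh:
  assumes "norm x < 1" "norm y < 1" "norm z < 1"
  shows "4 * (moebius x y \<bullet> moebius x z) / ((1 - (norm (moebius x y))\<^sup>2) * (1 - (norm (moebius x z))\<^sup>2))
      = hcosh (-x) y * hcosh (-x) z - hcosh y z"
proof -
  define X Y Z s t q where d: "X = (norm x)\<^sup>2" "Y = (norm y)\<^sup>2" "Z = (norm z)\<^sup>2" "s = x \<bullet> y" "t = x \<bullet> z" "q = y \<bullet> z"
  have lt: "X < 1" "Y < 1" "Z < 1" using assms norm_sq_less_1 by (auto simp: d)
  have D: "mden x y > 0" "mden x z > 0" using assms by (auto intro!: mden_pos)
  have "4 * (moebius x y \<bullet> moebius x z) / ((1 - (norm (moebius x y))\<^sup>2) * (1 - (norm (moebius x z))\<^sup>2))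
    = 4 * (moebius x y \<bullet> moebius x z) * (mden x y * mden x z) / (((1 - X) * (1 - Y)) * ((1 - X) * (1 - Z)))"
    using D by (simp add: one_minus_norm_moebius_sq d divide_simps)
  also have "\<dots> = 4 * ((1 + 2 * s + Y) * (1 + 2 * t + Z) * X + (1 + 2 * s + Y) * (1 - X) * t
     + (1 + 2 * t + Z) * (1 - X) * s + (1 - X)\<^sup>2 * q) / (((1 - X) * (1 - Y)) * ((1 - X) * (1 - Z)))"
    using D by (simp add: moebius_inner d)
  also have "\<dots> = (((1 + X) * (1 + Y) + 4 * s) * ((1 + X) * (1 + Z) + 4 * t) - ((1 + Y) * (1 + Z) - 4 * q) * (1 - X)\<^sup>2)
     / (((1 - X) * (1 - Y)) * ((1 - X) * (1 - Z)))"
    by (rule arg_cong[where f="\<lambda>w. w / _"]) algebra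
  also have "\<dots> = ((1 + X) * (1 + Y) + 4 * s) / ((1 - X) * (1 - Y)) * (((1 + X) * (1 + Z) + 4 * t) / ((1 - X) * (1 - Z)))
     - ((1 + Y) * (1 + Z) - 4 * q) / ((1 - Y) * (1 - Z))"
  proof -
    have "(w1 * w2 - w3 * (1 - X)\<^sup>2) / (((1 - X) * (1 - Y)) * ((1 - X) * (1 - Z)))
      = w1 / ((1 - X) * (1 - Y)) * (w2 / ((1 - X) * (1 - Z))) - w3 / ((1 - Y) * (1 - Z))" for w1 w2 w3 :: real
      using lt by (simp add: diff_divide_distrib power2_eq_square)
    then show ?thesis .
  qed
  also have "\<dots> = hcosh (-x) y * hcosh (-x) z - hcosh y z"
    by (simp add: hcosh_def d)
  finally show ?thesis .
qed

lemma hcosh_commute: "hcosh a b = hcosh b a"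
  by (simp add: hcosh_def inner_commute mult.commute)

lemma hcosh_eq: 
  assumes "norm a < 1" "norm b < 1"
  shows "hcosh a b = 1 + 2 * (norm (a - b))\<^sup>2 / ((1 - (norm a)\<^sup>2) * (1 - (norm b)\<^sup>2))"
proof -
  have "(norm (a - b))\<^sup>2 = (norm a)\<^sup>2 - 2 * (a \<bullet> b) + (norm b)\<^sup>2"
    unfolding dot_square_norm[symmetric] by (simp add: inner_diff_left inner_diff_right inner_commute)
  moreover have "(1 - (norm a)\<^sup>2) * (1 - (norm b)\<^sup>2) \<noteq> 0"
    using norm_sq_less_1[OF assms(1)] norm_sq_less_1[OF assms(2)] by simp
  ultimately show ?thesis
    unfolding hcosh_def by (simp add: field_simps)
qed

lemma hcosh_ge_1: "norm a < 1 \<Longrightarrow> norm b < 1 \<Longrightarrow> 1 \<le> hcosh a b"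
  using norm_sq_less_1[of a] norm_sq_less_1[of b] by (simp add: hcosh_eq)

lemma hcosh_gt_1: "norm a < 1 \<Longrightarrow> norm b < 1 \<Longrightarrow> a \<noteq> b \<Longrightarrow> 1 < hcosh a b"
  using norm_sq_less_1[of a] norm_sq_less_1[of b] by (simp add: hcosh_eq)

text \<open>For \<open>w = moebius x y\<close>, both coefficients in the numerator of
  \<open>moebius (-x) w\<close> are multiples of \<open>1 - X\<close>, so the \<open>x\<close> terms
  cancel, and the factor left on \<open>y\<close> equals the new denominator
  \<open>e1\<close>.\<close>

lemma moebius_inverse:
  assumes "norm x < 1" "norm y \<le> 1"
  shows "moebius (-x) (moebius x y) = y"
proof -
  define X Y s where d: "X = (norm x)\<^sup>2" "Y = (norm y)\<^sup>2" "s = x \<bullet> y"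
  define w where "w = moebius x y"
  have D: "mden x y > 0" using assms by (auto intro!: mden_pos)
  have Deq: "mden x y = 1 + 2 * s + X * Y" by (auto simp: mden_def d)
  have X: "X < 1" using assms norm_sq_less_1 by (auto simp: d)
  have xw: "x \<bullet> w = ((1 + 2 * s + Y) * X + (1 - X) * s) / mden x y"
    unfolding w_def inner_commute[of x "moebius x y"] moebius_inner_left
    by (simp add: d dot_square_norm inner_commute[of y x])
  have ww: "(norm w)\<^sup>2 = (X + 2 * s + Y) / mden x y"
    unfolding w_def d using D by (simp add: norm_moebius_sq)
  have e1: "mden (-x) w = (1 - X)\<^sup>2 / mden x y"
    unfolding mden_def[of "-x"] inner_minus_left xw ww norm_minus_cancel d(1)[symmetric] using D
    by (simp add: field_simps) (simp add: Deq algebra_simps power2_eq_square)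
  have e2: "1 + 2 * (-x \<bullet> w) + (norm w)\<^sup>2 = (1 - X) * (1 + 2 * s + Y) / mden x y"
    unfolding inner_minus_left xw ww d(1)[symmetric] using D
    by (simp add: field_simps) (simp add: Deq algebra_simps power2_eq_square)
  have e3: "w = (1 / mden x y) *\<^sub>R ((1 + 2 * s + Y) *\<^sub>R x + (1 - X) *\<^sub>R y)"
    by (simp add: w_def moebius_mden d divide_inverse)
  have "moebius (-x) w = (((1 - X) * (1 + 2 * s + Y) / mden x y) *\<^sub>R (-x) + (1 - X) *\<^sub>R w) /\<^sub>R ((1 - X)\<^sup>2 / mden x y)"
    unfolding moebius_mden[of "-x"] e1 e2 by (simp add: d)
  also have "\<dots> = (((1 - X)\<^sup>2 / mden x y) *\<^sub>R y) /\<^sub>R ((1 - X)\<^sup>2 / mden x y)"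
  proof -
    have "(c * a / D) *\<^sub>R (-x) + c *\<^sub>R ((1 / D) *\<^sub>R (a *\<^sub>R x + c *\<^sub>R y)) = (c\<^sup>2 / D) *\<^sub>R y" for c a D :: real
      by (simp add: scaleR_add_right power2_eq_square)
    then show ?thesis using e3 by metis
  qed
  also have "\<dots> = y" using D X by simp
  finally show ?thesis by (simp add: w_def)
qed

text \<open>\<open>moebius x\<close> keeps the distance from \<open>-x\<close> to \<open>y\<close>
  while moving \<open>-x\<close> to the origin, and a point of norm \<open>r\<close> has distance
  \<open>d\<close> from the origin with \<open>cosh d = (1 + r^2) / (1 - r^2)\<close>.\<close>

lemma hcosh_moebius:
  assumes "norm x < 1" "norm y < 1"
  shows "hcosh (-x) y = (1 + (norm (moebius x y))\<^sup>2) / (1 - (norm (moebius x y))\<^sup>2)"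
proof -
  define X Y s where d: "X = (norm x)\<^sup>2" "Y = (norm y)\<^sup>2" "s = x \<bullet> y"
  have D: "mden x y > 0" using assms by (auto intro!: mden_pos)
  have "1 + (norm (moebius x y))\<^sup>2 = ((1 + X) * (1 + Y) + 4 * s) / mden x y"
    using D by (simp add: norm_moebius_sq d field_simps) (simp add: mden_def algebra_simps)
  moreover have "1 - (norm (moebius x y))\<^sup>2 = (1 - X) * (1 - Y) / mden x y"
    using D by (simp add: one_minus_norm_moebius_sq d)
  ultimately show ?thesis
    using D by (simp add: hcosh_def d)
qed

lemma hcosh_sq_minus_1:
  assumes "norm x < 1" "norm y < 1"
  shows "(hcosh (-x) y)\<^sup>2 - 1 = (2 * norm (moebius x y) / (1 - (norm (moebius x y))\<^sup>2))\<^sup>2"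
proof -
  have "1 - (norm (moebius x y))\<^sup>2 \<noteq> 0"
    using norm_sq_less_1[OF norm_moebius_less_1[OF assms]] by simp
  then show ?thesis
    unfolding hcosh_moebius[OF assms]
    by (simp add: power_divide divide_simps) (simp add: power2_eq_square algebra_simps)
qed

section \<open>Angles of hyperbolic triangles\<close>

text \<open>Here \<open>p\<close>, \<open>q\<close>, \<open>m\<close> are the hyperbolic cosines of the side lengths of a hyperbolic triangle and \<open>P\<close>, \<open>Q\<close>, \<open>M\<close>
  the hyperbolic sines; by the law of cosines the two quotients are the cosines of the angles at the
  ends of the side \<open>m\<close>. The Gram determinant vanishes exactly for degenerate triangles.\<close>

lemma triangle_weighted_cos_sum:
  fixes p q m P Q M g0 g1 :: real
  assumes p: "1 \<le> p" "p \<le> q" and m: "1 < m"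
    and sq: "P\<^sup>2 = p\<^sup>2 - 1" "Q\<^sup>2 = q\<^sup>2 - 1" "M\<^sup>2 = m\<^sup>2 - 1" "0 \<le> P" "0 \<le> Q" "0 \<le> M"
    and gram: "0 \<le> 1 + 2 * p * q * m - p\<^sup>2 - q\<^sup>2 - m\<^sup>2"
    and g: "0 \<le> g0" "0 \<le> g1" "p < q \<Longrightarrow> g0 \<le> g1"
    and S: "S = g0 * ((p * m - q) / (P * M)) + g1 * ((q * m - p) / (Q * M))"
  shows "0 \<le> S"
    and "0 < g1 \<Longrightarrow> (p < q \<longrightarrow> g0 < g1) \<or> 0 < 1 + 2 * p * q * m - p\<^sup>2 - q\<^sup>2 - m\<^sup>2 \<Longrightarrow> 0 < S"
proof -
  let ?\<Delta> = "1 + 2 * p * q * m - p\<^sup>2 - q\<^sup>2 - m\<^sup>2"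
  \<comment> \<open>\<open>q = 1\<close> would force \<open>p = 1\<close> and a negative Gram
    determinant. Excluding it makes \<open>Q\<close> positive.\<close>
  have "q \<noteq> 1"
  proof
    assume "q = 1"
    then have "?\<Delta> = - (m - 1)\<^sup>2"
      using p by (simp add: power2_eq_square algebra_simps)
    with gram m show False by simp
  qed
  then have "1 < q" using p by simp
  have M: "0 < M" using sq m by (metis diff_gt_0_iff_gt one_less_power order_le_less zero_less_numeral zero_power2 less_irrefl)
  have Q: "0 < Q" using sq \<open>1 < q\<close> by (metis diff_gt_0_iff_gt one_less_power order_le_less zero_less_numeral zero_power2 less_irrefl)
  \<comment> \<open>The angle opposite \<open>p\<close>, which is not the longer side, is acute, so
    only the other cosine can be negative.\<close>
  have "p * 1 < q * m" using p m \<open>1 < q\<close> by (intro mult_le_less_imp_less) auto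
  then have qmp: "0 < q * m - p" by simp
  then have cb: "0 < (q * m - p) / (Q * M)" using Q M by simp
  have "0 \<le> S \<and> (0 < g1 \<longrightarrow> (p < q \<longrightarrow> g0 < g1) \<or> 0 < ?\<Delta> \<longrightarrow> 0 < S)"
  proof (cases "0 \<le> (p * m - q) / (P * M)")
    \<comment> \<open>If \<open>P = 0\<close>, the first quotient is 0 by the convention for
      division and falls under this case.\<close>
    case True
    then have "0 \<le> g0 * ((p * m - q) / (P * M))" by (intro mult_nonneg_nonneg g)
    moreover have "0 \<le> g1 * ((q * m - p) / (Q * M))" using g cb by (intro mult_nonneg_nonneg) auto
    moreover have "0 < g1 \<Longrightarrow> 0 < g1 * ((q * m - p) / (Q * M))" using cb by (intro mult_pos_pos)
    ultimately show ?thesis unfolding S by fastforce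
  next
    case False
    then have "P \<noteq> 0" by auto
    then have P: "0 < P" using sq by simp
    have "p * m < q"
      using False P M by (simp add: zero_le_divide_iff not_le mult_pos_pos)
    moreover have "p * 1 < p * m" using p m by (intro mult_strict_left_mono) auto
    ultimately have "p < q" by simp
    \<comment> \<open>With \<open>A\<close> and \<open>B\<close> below, \<open>-A\<close> and
      \<open>B\<close> are the two cosines. The comparison \<open>A \<le> B\<close> is squared to
      remove the square roots in \<open>P\<close> and \<open>Q\<close>; the difference carries the
      Gram determinant as a factor, hence strictness for non-degenerate triangles.\<close>
    have diff: "((q * m - p) * P)\<^sup>2 - ((q - p * m) * Q)\<^sup>2 = ?\<Delta> * (q\<^sup>2 - p\<^sup>2)"
      unfolding power_mult_distrib sq by (simp add: power2_eq_square algebra_simps)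
    have q2p2: "0 < q\<^sup>2 - p\<^sup>2" using \<open>p < q\<close> p by (simp add: power_strict_mono)
    have le: "(q - p * m) * Q \<le> (q * m - p) * P"
    proof (rule power2_le_imp_le)
      have "0 \<le> ?\<Delta> * (q\<^sup>2 - p\<^sup>2)" using gram q2p2 by simp
      then show "((q - p * m) * Q)\<^sup>2 \<le> ((q * m - p) * P)\<^sup>2" using diff by linarith
      show "0 \<le> (q * m - p) * P" using qmp P by simp
    qed
    have less: "(q - p * m) * Q < (q * m - p) * P" if "0 < ?\<Delta>"
    proof (rule power2_less_imp_less)
      have "0 < ?\<Delta> * (q\<^sup>2 - p\<^sup>2)" using that q2p2 by simp
      then show "((q - p * m) * Q)\<^sup>2 < ((q * m - p) * P)\<^sup>2" using diff by linarith
      show "0 \<le> (q * m - p) * P" using qmp P by simp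
    qed
    define A B where AB: "A = (q - p * m) / (P * M)" "B = (q * m - p) / (Q * M)"
    have "(p * m - q) / (P * M) = - A" by (simp add: AB minus_divide_left)
    then have S': "S = g1 * B - g0 * A" by (simp add: S AB)
    have A: "0 < A" unfolding AB using P M \<open>p * m < q\<close> by simp
    have "A \<le> B" unfolding AB using le P Q M by (simp add: divide_simps mult.commute)
    have AB_less: "A < B" if "0 < ?\<Delta>" unfolding AB using less[OF that] P Q M by (simp add: divide_simps mult.commute)
    have "g0 \<le> g1" using g \<open>p < q\<close> by simp
    \<comment> \<open>In the chain \<open>g0 * A \<le> g1 * A \<le> g1 * B\<close>, the first
      inequality is strict if \<open>g\<close> increases strictly, the second if the triangle is
      non-degenerate and \<open>g1 > 0\<close>.\<close>
    have 1: "g0 * A \<le> g1 * A" using A \<open>g0 \<le> g1\<close> by simp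
    have 2: "g1 * A \<le> g1 * B" using \<open>A \<le> B\<close> g by (intro mult_left_mono) auto
    have 3: "g0 * A < g1 * A" if "g0 < g1" using that A by simp
    have 4: "g1 * A < g1 * B" if "0 < ?\<Delta>" "0 < g1" using AB_less that by simp
    show ?thesis unfolding S' using 1 2 3 4 \<open>p < q\<close> by (meson diff_ge_0_iff_ge diff_gt_0_iff_gt le_less_trans less_le_trans order_trans)
  qed
  then show "0 \<le> S"
    "0 < g1 \<Longrightarrow> (p < q \<longrightarrow> g0 < g1) \<or> 0 < ?\<Delta> \<Longrightarrow> 0 < S" by auto
qed

lemma one_plus_over_one_minus_less:
  fixes r s :: real
  assumes "0 \<le> r" "r < 1" "0 \<le> s" "s < 1"
  shows "(1 + r\<^sup>2) / (1 - r\<^sup>2) < (1 + s\<^sup>2) / (1 - s\<^sup>2) \<longleftrightarrow> r < s"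
proof -
  have "r\<^sup>2 < 1" "s\<^sup>2 < 1" using assms by (auto simp: abs_square_less_1)
  then have "(1 + r\<^sup>2) / (1 - r\<^sup>2) < (1 + s\<^sup>2) / (1 - s\<^sup>2) \<longleftrightarrow> r\<^sup>2 < s\<^sup>2"
    by (simp add: divide_simps algebra_simps)
  also have "\<dots> \<longleftrightarrow> r < s"
    using assms by (metis power_strict_mono power2_less_imp_less zero_less_numeral)
  finally show ?thesis .
qed

text \<open>\<open>moebius x\<close> moves \<open>-x\<close> to the origin, so this is \<open>g(r) cos \<alpha> + g(s) cos \<beta>\<close> for the triangle with vertices
  \<open>-x\<close>, \<open>-z\<close>, \<open>y\<close>, where \<open>\<alpha>\<close> and \<open>\<beta>\<close> are the angles at \<open>-x\<close> and \<open>-z\<close>.\<close>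

definition angular_sum :: "(real \<Rightarrow> real) \<Rightarrow> real ^ 'n \<Rightarrow> real ^ 'n \<Rightarrow> real ^ 'n \<Rightarrow> real" where
  "angular_sum g x z y = radial_field g (moebius x y) \<bullet> sgn (moebius x (-z))
     + radial_field g (moebius z y) \<bullet> sgn (moebius z (-x))"

lemma angular_sum_commute: "angular_sum g x z y = angular_sum g z x y"
  by (simp add: angular_sum_def)

text \<open>Dividing \<open>moebius_hcosh\<close> by the two hyperbolic sines gives the cosine of
  the angle at \<open>-x\<close>. If one of the two image vectors is 0, both sides are 0.\<close>

lemma radial_field_inner_sgn:
  assumes "norm x < 1" "norm y < 1" "norm z < 1" "g 0 = 0"
  shows "radial_field g (moebius x y) \<bullet> sgn (moebius x z) = g (norm (moebius x y)) *
     ((hcosh (-x) y * hcosh (-x) z - hcosh y z) / ((2 * norm (moebius x y) / (1 - (norm (moebius x y))\<^sup>2))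
       * (2 * norm (moebius x z) / (1 - (norm (moebius x z))\<^sup>2))))"
proof -
  define a b where ab: "a = moebius x y" "b = moebius x z"
  have "(norm a)\<^sup>2 < 1" "(norm b)\<^sup>2 < 1"
    unfolding ab using norm_moebius_less_1 norm_sq_less_1 assms by blast+
  moreover have "radial_field g a \<bullet> sgn b = g (norm a) * ((a \<bullet> b) / (norm a * norm b))"
    using assms by (auto simp: radial_field_def sgn_div_norm divide_inverse)
  moreover have "k / (\<alpha> * \<beta>) = 4 * k / (A * B) / ((2 * \<alpha> / A) * (2 * \<beta> / B))"
    if "A \<noteq> 0" "B \<noteq> 0" for k \<alpha> \<beta> A B :: real
    using that by simp
  from this[of "1 - (norm a)\<^sup>2" "1 - (norm b)\<^sup>2" "a \<bullet> b" "norm a" "norm b"]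
  have "(a \<bullet> b) / (norm a * norm b) = 4 * (a \<bullet> b) / ((1 - (norm a)\<^sup>2) * (1 - (norm b)\<^sup>2))
      / ((2 * norm a / (1 - (norm a)\<^sup>2)) * (2 * norm b / (1 - (norm b)\<^sup>2)))"
    using calculation by linarith
  ultimately show ?thesis
    unfolding moebius_hcosh[OF assms(1-3), symmetric] unfolding ab[symmetric] by (simp only:)
qed

text \<open>Up to a positive factor, the hyperbolic Gram determinant is the Euclidean one of
  \<open>moebius x y\<close> and \<open>moebius x z\<close>. By Cauchy-Schwarz it is nonnegative,
  and it vanishes only if these vectors are linearly dependent.\<close>

lemma gram_eq:
  assumes "norm x < 1" "norm y < 1" "norm z < 1"
  defines "p \<equiv> hcosh (-x) y" and "m \<equiv> hcosh (-x) z" and "q \<equiv> hcosh y z"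
  shows "1 + 2 * p * q * m - p\<^sup>2 - q\<^sup>2 - m\<^sup>2 =
    16 * ((norm (moebius x y) * norm (moebius x z))\<^sup>2 - (moebius x y \<bullet> moebius x z)\<^sup>2)
      / ((1 - (norm (moebius x y))\<^sup>2) * (1 - (norm (moebius x z))\<^sup>2))\<^sup>2"
proof -
  have "1 + 2 * p * q * m - p\<^sup>2 - q\<^sup>2 - m\<^sup>2 = (p\<^sup>2 - 1) * (m\<^sup>2 - 1) - (p * m - q)\<^sup>2"
    by (simp add: power2_eq_square algebra_simps)
  also have "\<dots> = (2 * norm (moebius x y) / (1 - (norm (moebius x y))\<^sup>2))\<^sup>2 * (2 * norm (moebius x z) / (1 - (norm (moebius x z))\<^sup>2))\<^sup>2
   - (4 * (moebius x y \<bullet> moebius x z) / ((1 - (norm (moebius x y))\<^sup>2) * (1 - (norm (moebius x z))\<^sup>2)))\<^sup>2"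
    unfolding p_def m_def q_def hcosh_sq_minus_1[OF assms(1,2)] hcosh_sq_minus_1[OF assms(1,3)]
      moebius_hcosh[OF assms(1-3)] ..
  also have "\<dots> = 16 * ((norm (moebius x y) * norm (moebius x z))\<^sup>2 - (moebius x y \<bullet> moebius x z)\<^sup>2)
      / ((1 - (norm (moebius x y))\<^sup>2) * (1 - (norm (moebius x z))\<^sup>2))\<^sup>2"
  proof -
    have "(2 * k / A)\<^sup>2 * (2 * l / B)\<^sup>2 - (4 * i / (A * B))\<^sup>2 = 16 * ((k * l)\<^sup>2 - i\<^sup>2) / (A * B)\<^sup>2" for k l i A B :: real
      by (simp add: power_divide power_mult_distrib diff_divide_distrib right_diff_distrib)
    then show ?thesis .
  qed
  finally show ?thesis .
qed

text \<open>\<open>triangle_weighted_cos_sum\<close> needs \<open>p \<le> q\<close>.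
  \<open>main\<close> treats this case for arbitrary \<open>x\<close> and \<open>z\<close>, and
  exchanging them gives the other. It expresses non-degeneracy by the Gram determinant, which is
  visibly symmetric in \<open>x\<close> and \<open>z\<close>, unlike the alignment
  condition.\<close>

lemma angular_sum_pos:
  assumes norms: "norm x < 1" "norm y < 1" "norm z < 1" and "x \<noteq> z"
    and mono: "mono_on {0..<1} g" and "g 0 = 0"
  shows "0 \<le> angular_sum g x z y"
    and "strict_mono_on {0..<1} g \<or> ((\<forall>r. 0 < r \<and> r < 1 \<longrightarrow> 0 < g r) \<and>
           (moebius x y \<bullet> moebius x (-z))\<^sup>2 \<noteq> (norm (moebius x y) * norm (moebius x (-z)))\<^sup>2)
         \<Longrightarrow> 0 < angular_sum g x z y"
proof -
  have main: "0 \<le> angular_sum g x z y \<and> 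
     (strict_mono_on {0..<1} g \<or> ((\<forall>r. 0 < r \<and> r < 1 \<longrightarrow> 0 < g r) \<and>
         0 < 1 + 2 * hcosh (-x) y * hcosh (-z) y * hcosh x z - (hcosh (-x) y)\<^sup>2 - (hcosh (-z) y)\<^sup>2 - (hcosh x z)\<^sup>2)
      \<longrightarrow> 0 < angular_sum g x z y)"
    if x: "norm x < 1" and z: "norm z < 1" and "x \<noteq> z" and le: "hcosh (-x) y \<le> hcosh (-z) y" for x z
  proof -
    define p q m where pqm: "p = hcosh (-x) y" "q = hcosh (-z) y" "m = hcosh x z"
    define r s where rs: "r = norm (moebius x y)" "s = norm (moebius z y)"
    define P Q M where PQM: "P = 2 * r / (1 - r\<^sup>2)" "Q = 2 * s / (1 - s\<^sup>2)"
      "M = 2 * norm (moebius x (-z)) / (1 - (norm (moebius x (-z)))\<^sup>2)"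
    have nz: "norm (-z) < 1" "norm (-x) < 1" using x z by auto
    have m1: "hcosh (-x) (-z) = m" "hcosh (-z) (-x) = m"
      by (simp_all add: pqm hcosh_def inner_commute mult.commute)
    \<comment> \<open>Both norms encode the distance between \<open>-x\<close> and
      \<open>-z\<close>, so one \<open>M\<close> serves both terms.\<close>
    have mz: "norm (moebius z (-x)) = norm (moebius x (-z))"
    proof -
      have "norm (moebius z (-x)) < 1" "norm (moebius x (-z)) < 1"
        using norm_moebius_less_1 x z by force+
      moreover have "(1 + (norm (moebius z (-x)))\<^sup>2) / (1 - (norm (moebius z (-x)))\<^sup>2)
         = (1 + (norm (moebius x (-z)))\<^sup>2) / (1 - (norm (moebius x (-z)))\<^sup>2)"
        using hcosh_moebius[OF x nz(1)] hcosh_moebius[OF z nz(2)] m1 by simp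
      ultimately show ?thesis
        by (metis one_plus_over_one_minus_less norm_ge_zero less_irrefl linorder_neqE)
    qed
    have S: "angular_sum g x z y = g r * ((p * m - q) / (P * M)) + g s * ((q * m - p) / (Q * M))"
      unfolding angular_sum_def radial_field_inner_sgn[where g=g, OF x norms(2) nz(1) \<open>g 0 = 0\<close>]
        radial_field_inner_sgn[where g=g, OF z norms(2) nz(2) \<open>g 0 = 0\<close>] m1
      by (simp add: PQM rs pqm mz hcosh_commute[of y])
    have r1: "r < 1" "s < 1" "0 \<le> r" "0 \<le> s"
      unfolding rs using norm_moebius_less_1 x z norms by auto
    then have rs1: "r\<^sup>2 < 1" "s\<^sup>2 < 1" by (auto simp: abs_square_less_1)
    have sq: "P\<^sup>2 = p\<^sup>2 - 1" "Q\<^sup>2 = q\<^sup>2 - 1" "M\<^sup>2 = m\<^sup>2 - 1"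
      unfolding PQM rs pqm(1,2) m1(1)[symmetric]
      by (simp_all add: hcosh_sq_minus_1 x z norms)
    have nn: "0 \<le> P" "0 \<le> Q" "0 \<le> M"
      unfolding PQM using r1 rs1 norm_sq_less_1[OF norm_moebius_less_1[OF x nz(1)]] by auto
    have m: "1 < m" unfolding pqm using x z \<open>x \<noteq> z\<close> by (rule hcosh_gt_1)
    have p: "1 \<le> p" "p \<le> q" using le hcosh_ge_1[of "-x" y] x norms by (auto simp: pqm)
    have "(moebius x y \<bullet> moebius x (- z))\<^sup>2 \<le> (norm (moebius x y) * norm (moebius x (- z)))\<^sup>2"
      by (metis Cauchy_Schwarz_ineq2 abs_ge_zero power2_abs power_mono)
    then have gram: "0 \<le> 1 + 2 * p * q * m - p\<^sup>2 - q\<^sup>2 - m\<^sup>2"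
      using gram_eq[OF x norms(2) nz(1)] m1 unfolding hcosh_commute[of y] pqm[symmetric] 
      by simp
    have pq: "p < q \<longleftrightarrow> r < s"
      unfolding pqm using one_plus_over_one_minus_less[of r s] r1 
      by (simp add: hcosh_moebius x z norms rs)
    have g: "0 \<le> g r" "0 \<le> g s"
      using mono_onD[OF mono, of 0 r] mono_onD[OF mono, of 0 s] r1 \<open>g 0 = 0\<close> by auto
    have gle: "p < q \<Longrightarrow> g r \<le> g s"
      using mono_onD[OF mono, of r s] r1 pq by auto
    \<comment> \<open>\<open>s = 0\<close> would collapse the longer side, again making the Gram
      determinant negative. With \<open>s > 0\<close> comes \<open>g s > 0\<close>, which strictness
      needs.\<close>
    have "s \<noteq> 0"
    proof
      assume "s = 0"
      then have "Q = 0" by (simp add: PQM)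
      then have "q\<^sup>2 = 1" using sq by simp
      then have "q = 1" using p by (metis abs_of_nonneg one_power2 order_trans power2_eq_iff_nonneg zero_le_one)
      then have "1 + 2 * p * q * m - p\<^sup>2 - q\<^sup>2 - m\<^sup>2 = - (m - 1)\<^sup>2"
        using p by (simp add: power2_eq_square algebra_simps)
      with gram m show False by simp
    qed
    then have s: "0 < s" using r1 by simp
    have gs: "strict_mono_on {0..<1} g \<Longrightarrow> 0 < g s"
      using s r1 \<open>g 0 = 0\<close> strict_mono_onD[of "{0..<1}" g 0 s] by auto
    have gstrict: "strict_mono_on {0..<1} g \<Longrightarrow> p < q \<longrightarrow> g r < g s"
      using r1 pq strict_mono_onD[of "{0..<1}" g r s] by auto
    note aux = triangle_weighted_cos_sum[OF p m sq nn gram g gle S]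
    show ?thesis using aux gs gstrict s r1 unfolding pqm by blast
  qed
  have nz: "norm (-z) < 1" using norms by simp
  have m1: "hcosh (-x) (-z) = hcosh x z" by (simp add: hcosh_def)
  have gram_pos: "0 < 1 + 2 * hcosh (-x) y * hcosh (-z) y * hcosh x z - (hcosh (-x) y)\<^sup>2 - (hcosh (-z) y)\<^sup>2 - (hcosh x z)\<^sup>2"
    if "(moebius x y \<bullet> moebius x (-z))\<^sup>2 \<noteq> (norm (moebius x y) * norm (moebius x (-z)))\<^sup>2"
  proof -
    have "(moebius x y \<bullet> moebius x (- z))\<^sup>2 \<le> (norm (moebius x y) * norm (moebius x (- z)))\<^sup>2"
      by (metis Cauchy_Schwarz_ineq2 abs_ge_zero power2_abs power_mono)
    moreover have "0 < ((1 - (norm (moebius x y))\<^sup>2) * (1 - (norm (moebius x (- z)))\<^sup>2))\<^sup>2"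
      using norm_sq_less_1[OF norm_moebius_less_1[OF norms(1) nz]] norm_sq_less_1[OF norm_moebius_less_1[OF norms(1,2)]]
      by simp
    ultimately show ?thesis
      using that gram_eq[OF norms(1,2) nz] m1 unfolding hcosh_commute[of y] by simp
  qed
  have sw: "1 + 2 * hcosh (-x) y * hcosh (-z) y * hcosh x z - (hcosh (-x) y)\<^sup>2 - (hcosh (-z) y)\<^sup>2 - (hcosh x z)\<^sup>2
    = 1 + 2 * hcosh (-z) y * hcosh (-x) y * hcosh z x - (hcosh (-z) y)\<^sup>2 - (hcosh (-x) y)\<^sup>2 - (hcosh z x)\<^sup>2"
    by (simp add: hcosh_commute[of z x])
  have both: "0 \<le> angular_sum g x z y \<and> 
     (strict_mono_on {0..<1} g \<or> ((\<forall>r. 0 < r \<and> r < 1 \<longrightarrow> 0 < g r) \<and>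
         0 < 1 + 2 * hcosh (-x) y * hcosh (-z) y * hcosh x z - (hcosh (-x) y)\<^sup>2 - (hcosh (-z) y)\<^sup>2 - (hcosh x z)\<^sup>2)
      \<longrightarrow> 0 < angular_sum g x z y)"
  proof (cases "hcosh (-x) y \<le> hcosh (-z) y")
    case True
    then show ?thesis using main[of x z] norms \<open>x \<noteq> z\<close> by blast
  next
    case False
    then show ?thesis
      unfolding sw angular_sum_commute[of g x z] using main[of z x] norms \<open>x \<noteq> z\<close> by (simp only: linear not_le less_imp_le) (metis less_imp_le)
  qed
  then show "0 \<le> angular_sum g x z y"
    and "strict_mono_on {0..<1} g \<or> ((\<forall>r. 0 < r \<and> r < 1 \<longrightarrow> 0 < g r) \<and>
           (moebius x y \<bullet> moebius x (-z))\<^sup>2 \<noteq> (norm (moebius x y) * norm (moebius x (-z)))\<^sup>2)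
         \<Longrightarrow> 0 < angular_sum g x z y"
    using gram_pos by blast+
qed

section \<open>Geodesics as images of diameters\<close>

lemma orthonormal_norm_sq:
  fixes u w :: "'a::real_inner"
  assumes "norm u = 1" "norm w = 1" "u \<bullet> w = 0"
  shows "(norm (a *\<^sub>R u + b *\<^sub>R w))\<^sup>2 = a\<^sup>2 + b\<^sup>2"
proof -
  have "w \<bullet> u = 0" "u \<bullet> u = 1" "w \<bullet> w = 1"
    using assms by (simp_all add: inner_commute dot_square_norm)
  then have "(a *\<^sub>R u + b *\<^sub>R w) \<bullet> (a *\<^sub>R u + b *\<^sub>R w) = a\<^sup>2 + b\<^sup>2"
    using assms(3) by (simp add: inner_add_left inner_add_right power2_eq_square)
  then show ?thesis by (simp add: dot_square_norm)
qed

lemma circle_path_surj: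
  assumes uw: "norm u = 1" "norm w = 1" "u \<bullet> w = 0" and "0 < r"
    and y: "y = c + (a *\<^sub>R u + b *\<^sub>R w)" and "norm (y - c) = r"
  shows "y \<in> range (circle_path c r u w)"
proof -
  have "a\<^sup>2 + b\<^sup>2 = r\<^sup>2"
    using orthonormal_norm_sq[OF uw, of a b] assms by simp
  then have "(a / r)\<^sup>2 + (b / r)\<^sup>2 = 1"
    using \<open>0 < r\<close> by (simp add: power_divide flip: add_divide_distrib)
  then obtain t where "a / r = cos t" "b / r = sin t"
    using sincos_total_2pi by metis
  then have "y = circle_path c r u w t"
    using \<open>0 < r\<close> unfolding circle_path_def y by (simp add: scaleR_add_right field_simps)
  then show ?thesis by blast
qed

text \<open>\<open>|c|^2 = 1 + r^2\<close> is Pythagoras: at a common point \<open>q\<close> the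
  radius \<open>q - c\<close> is orthogonal to \<open>q\<close>. Since \<open>c\<close> lies in the
  span of \<open>u\<close> and \<open>w\<close>, so does \<open>q\<close>, which is therefore a
  multiple of the velocity direction.\<close>

lemma circle_orthogonal_to_sphereI:
  fixes c :: "real ^ 'n"
  assumes uw: "norm u = 1" "norm w = 1" "u \<bullet> w = 0"
    and c: "c = c1 *\<^sub>R u + c2 *\<^sub>R w" "(norm c)\<^sup>2 = 1 + r\<^sup>2" and "0 < r"
    and meet: "p \<in> range (circle_path c r u w)" "norm p = 1"
  shows "circle_orthogonal_to_sphere c r u w"
  unfolding circle_orthogonal_to_sphere_def
proof (intro conjI allI impI)
  show "\<exists>t. circle_path c r u w t \<in> sphere 0 1" using meet by auto
  fix t h
  define n where "n = cos t *\<^sub>R u + sin t *\<^sub>R w"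
  define n' where "n' = - sin t *\<^sub>R u + cos t *\<^sub>R w"
  define q where "q = circle_path c r u w t"
  assume "circle_path c r u w t \<in> sphere 0 1" and h: "h \<bullet> circle_path c r u w t = 0"
  then have q1: "q \<bullet> q = 1" by (simp add: q_def dot_square_norm)
  have wu: "w \<bullet> u = 0" "u \<bullet> u = 1" "w \<bullet> w = 1" using uw by (simp_all add: inner_commute dot_square_norm)
  have q: "q = c + r *\<^sub>R n" by (simp add: q_def circle_path_def n_def)
  have nn: "n \<bullet> n = 1" 
    using orthonormal_norm_sq[OF uw, of "cos t" "sin t"] by (simp add: n_def dot_square_norm)
  have "q \<bullet> q = c \<bullet> c + 2 * r * (n \<bullet> c) + r\<^sup>2"
    unfolding q by (simp add: inner_add_left inner_add_right nn inner_commute power2_eq_square)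
  then have "r * (n \<bullet> c + r) = 0" using q1 c(2) by (simp add: dot_square_norm power2_eq_square algebra_simps)
  then have nc: "n \<bullet> c + r = 0" using \<open>0 < r\<close> by simp
  then have nq: "n \<bullet> q = 0" unfolding q by (simp add: inner_add_right nn)
  define k1 k2 where k: "k1 = c1 + r * cos t" "k2 = c2 + r * sin t"
  have qk: "q = k1 *\<^sub>R u + k2 *\<^sub>R w" unfolding q c n_def k by (simp add: algebra_simps)
  have e1: "k1 * cos t + k2 * sin t = 0"
    using nq unfolding qk n_def using wu uw by (simp add: inner_add_left inner_add_right algebra_simps)
  have "(norm q)\<^sup>2 = k1\<^sup>2 + k2\<^sup>2" unfolding qk by (rule orthonormal_norm_sq[OF uw])
  then have kk: "k1\<^sup>2 + k2\<^sup>2 = 1" using q1 by (simp add: dot_square_norm)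
  \<comment> \<open>\<open>k\<close> is the coordinate of \<open>q\<close> along \<open>n'\<close>;
    the coordinate along \<open>n\<close> is 0 by \<open>e1\<close>, and \<open>|q| = 1\<close>
    makes \<open>k\<close> nonzero.\<close>
  define k where "k = k2 * cos t - k1 * sin t"
  have sc: "(sin t)\<^sup>2 + (cos t)\<^sup>2 = 1" by simp
  have "k1 = - sin t * k" unfolding k_def using e1 sc by algebra
  moreover have "k2 = cos t * k" unfolding k_def using e1 sc by algebra
  ultimately have "q = k *\<^sub>R n'" unfolding qk n'_def by (simp add: algebra_simps)
  moreover have "k \<noteq> 0" using \<open>k1 = - sin t * k\<close> \<open>k2 = cos t * k\<close> kk by auto
  ultimately have "h \<bullet> n' = 0" using h unfolding q_def[symmetric] by simp
  then show "h \<bullet> circle_velocity r u w t = 0" by (simp add: circle_velocity_def n'_def)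
qed

text \<open>Equivalent to \<open>1 + |y|^2 = 2 (c \<bullet> y)\<close>. After multiplication by the
  denominator, the two conditions on \<open>c\<close> turn both sides into
  \<open>(1 + X) (1 + t^2) + 4 t s\<close>.\<close>

lemma moebius_diameter_circle:
  fixes a u c :: "real ^ 'n"
  assumes "norm a < 1" "norm u = 1" "\<bar>t\<bar> \<le> 1"
    and c: "c \<bullet> u = a \<bullet> u" "2 * (c \<bullet> a) = 1 + (norm a)\<^sup>2"
  shows "(norm (moebius a (t *\<^sub>R u) - c))\<^sup>2 = (norm c)\<^sup>2 - 1"
proof -
  define X s where d: "X = (norm a)\<^sup>2" "s = a \<bullet> u"
  define y where "y = moebius a (t *\<^sub>R u)"
  have D: "mden a (t *\<^sub>R u) > 0" using assms by (auto intro!: mden_pos)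
  have Deq: "mden a (t *\<^sub>R u) = 1 + 2 * t * s + X * t\<^sup>2" using assms by (simp add: mden_def d)
  have "1 + (norm y)\<^sup>2 = (1 + X) * (1 + t\<^sup>2) / mden a (t *\<^sub>R u) + 4 * t * s / mden a (t *\<^sub>R u)"
    unfolding y_def using D assms
    by (simp add: norm_moebius_sq field_simps) (simp add: Deq d algebra_simps)
  moreover have "2 * (y \<bullet> c) = ((1 + 2 * t * s + t\<^sup>2) * (2 * (c \<bullet> a)) + (1 - X) * (2 * t * (c \<bullet> u))) / mden a (t *\<^sub>R u)"
    unfolding y_def moebius_inner_left using assms(2)
    by (simp add: d inner_commute[of a c] inner_commute[of u c] algebra_simps)
  moreover have "\<dots> = ((1 + X) * (1 + t\<^sup>2) + 4 * t * s) / mden a (t *\<^sub>R u)"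
    unfolding c d by (simp add: algebra_simps)
  ultimately have "2 * (y \<bullet> c) = 1 + (norm y)\<^sup>2" by (simp add: add_divide_distrib)
  moreover have "(norm (y - c))\<^sup>2 = (norm y)\<^sup>2 - 2 * (y \<bullet> c) + (norm c)\<^sup>2"
    unfolding dot_square_norm[symmetric] by (simp add: inner_diff_left inner_diff_right inner_commute)
  ultimately show ?thesis by (simp add: y_def)
qed

text \<open>If \<open>a\<close> lies on the line of \<open>u\<close>, the diameter goes into itself,
  otherwise into a circle in the plane of \<open>a\<close> and \<open>u\<close>. Containment
  suffices, since \<open>\<gamma>\<close> only has to carry a measure.\<close>

lemma geodesic_through_moebius_diameter:
  fixes a u :: "real ^ 'n"
  assumes a: "norm a < 1" and u: "norm u = 1"
  obtains \<gamma> where "hyperbolic_geodesic \<gamma>" "\<And>t. \<bar>t\<bar> < 1 \<Longrightarrow> moebius a (t *\<^sub>R u) \<in> \<gamma>"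
proof (cases "a = (a \<bullet> u) *\<^sub>R u")
  case True
  define s where "s = a \<bullet> u"
  have a_eq: "a = s *\<^sub>R u" using True by (simp add: s_def)
  let ?\<gamma> = "{t *\<^sub>R u | t. -1 < t \<and> t < 1}"
  show ?thesis
  proof
    show "hyperbolic_geodesic ?\<gamma>" unfolding hyperbolic_geodesic_def using u by blast
    fix t :: real assume t: "\<bar>t\<bar> < 1"
    have "moebius a (t *\<^sub>R u) = (((1 + 2 * (a \<bullet> (t *\<^sub>R u)) + (norm (t *\<^sub>R u))\<^sup>2) * s + (1 - (norm a)\<^sup>2) * t) / mden a (t *\<^sub>R u)) *\<^sub>R u"
      (is "_ = ?k *\<^sub>R u")
      unfolding moebius_mden by (subst (3) a_eq) (simp add: divide_inverse algebra_simps)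
    moreover have "norm (moebius a (t *\<^sub>R u)) < 1"
      using a u t by (intro norm_moebius_less_1) auto
    ultimately have "\<bar>?k\<bar> < 1" using u by simp
    with \<open>moebius a (t *\<^sub>R u) = ?k *\<^sub>R u\<close> show "moebius a (t *\<^sub>R u) \<in> ?\<gamma>"
      by (smt (verit) mem_Collect_eq abs_less_iff)
  qed
next
  case False
  define s where "s = a \<bullet> u"
  define b where "b = a - s *\<^sub>R u"
  define w where "w = sgn b"
  define h where "h = norm b"
  have "b \<noteq> 0" using False by (simp add: b_def s_def)
  then have h: "0 < h" by (simp add: h_def)
  have bw: "b = h *\<^sub>R w" using \<open>b \<noteq> 0\<close> by (simp add: w_def h_def sgn_div_norm)
  have w: "norm w = 1" using \<open>b \<noteq> 0\<close> by (simp add: w_def norm_sgn)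
  have "u \<bullet> b = 0" unfolding b_def s_def using u by (simp add: inner_diff_right inner_commute dot_square_norm)
  then have uw: "u \<bullet> w = 0" using h unfolding bw by simp
  have wu: "w \<bullet> u = 0" using uw by (simp add: inner_commute)
  have a_eq: "a = s *\<^sub>R u + h *\<^sub>R w" using bw by (simp add: b_def diff_eq_eq add.commute)
  have a2: "(norm a)\<^sup>2 = s\<^sup>2 + h\<^sup>2" unfolding a_eq by (rule orthonormal_norm_sq[OF u w uw])
  \<comment> \<open>The image of the diameter lies on the circle \<open>1 + |y|\<^sup>2 = 2 (c \<bullet> y)\<close>; matching position and direction at
    \<open>t = 0\<close> gives \<open>2 (c \<bullet> a) = 1 + |a|\<^sup>2\<close> and \<open>c \<bullet> u = a \<bullet> u\<close>, which determine \<open>c\<close> in the span of \<open>u\<close> and \<open>w\<close>.\<close>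
  define k where "k = (1 + h\<^sup>2 - s\<^sup>2) / (2 * h)"
  define c where "c = s *\<^sub>R u + k *\<^sub>R w"
  \<comment> \<open>The closed form of \<open>sqrt (|c|^2 - 1)\<close>, confirmed in
    \<open>rc\<close>.\<close>
  define r where "r = (1 - (norm a)\<^sup>2) / (2 * h)"
  have r: "0 < r" unfolding r_def using h norm_sq_less_1[OF a] by simp
  have cu: "c \<bullet> u = a \<bullet> u" unfolding c_def using u wu by (simp add: inner_add_left s_def dot_square_norm)
  have ca: "2 * (c \<bullet> a) = 1 + (norm a)\<^sup>2"
    unfolding c_def a2 unfolding a_eq using u w wu uw h
    by (simp add: inner_add_left inner_add_right dot_square_norm k_def power2_eq_square algebra_simps add_divide_distrib diff_divide_distrib)
  have c2: "(norm c)\<^sup>2 = s\<^sup>2 + k\<^sup>2" unfolding c_def by (rule orthonormal_norm_sq[OF u w uw])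
  have rc: "(norm c)\<^sup>2 - 1 = r\<^sup>2"
    unfolding c2 k_def r_def a2 using h
    by (simp add: power_divide power_mult_distrib divide_simps) (simp add: power2_eq_square algebra_simps)
  have in_range: "moebius a (t *\<^sub>R u) \<in> range (circle_path c r u w)" if "\<bar>t\<bar> \<le> 1" for t
  proof -
    let ?A = "1 + 2 * (a \<bullet> (t *\<^sub>R u)) + (norm (t *\<^sub>R u))\<^sup>2" and ?B = "1 - (norm a)\<^sup>2" and ?D = "mden a (t *\<^sub>R u)"
    have "moebius a (t *\<^sub>R u) = ((?A * s + ?B * t) / ?D) *\<^sub>R u + (?A * h / ?D) *\<^sub>R w"
      unfolding moebius_mden by (subst (3) a_eq) (simp add: divide_inverse algebra_simps)
    then have "moebius a (t *\<^sub>R u) = c + (((?A * s + ?B * t) / ?D - s) *\<^sub>R u + (?A * h / ?D - k) *\<^sub>R w)"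
      by (simp add: c_def algebra_simps)
    moreover have "norm (moebius a (t *\<^sub>R u) - c) = r"
      using moebius_diameter_circle[OF a u that cu ca] r rc
      by (metis norm_ge_zero less_imp_le power2_eq_iff_nonneg)
    ultimately show ?thesis by (intro circle_path_surj[OF u w uw r])
  qed
  \<comment> \<open>The endpoint \<open>t = 1\<close> lands on the sphere and supplies the common
    point that orthogonality demands; for its sake \<open>in_range\<close> admits
    \<open>|t| = 1\<close>.\<close>
  have "norm (moebius a u) = 1"
  proof -
    have "mden a u > 0" using a u by (auto intro!: mden_pos)
    then have "1 - (norm (moebius a u))\<^sup>2 = 0" using u by (simp add: one_minus_norm_moebius_sq)
    then show ?thesis by (simp add: power2_eq_1_iff) (smt (verit) norm_ge_zero)
  qed
  then have "circle_orthogonal_to_sphere c r u w"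
    using in_range[of 1] rc by (intro circle_orthogonal_to_sphereI[OF u w uw c_def _ r, of "moebius a u"]) auto
  then have "hyperbolic_geodesic (range (circle_path c r u w) \<inter> ball 0 1)"
    unfolding hyperbolic_geodesic_def using r u w uw by blast
  moreover have "moebius a (t *\<^sub>R u) \<in> range (circle_path c r u w) \<inter> ball 0 1" if "\<bar>t\<bar> < 1" for t
    using in_range[of t] norm_moebius_less_1[of a "t *\<^sub>R u"] a u that by auto
  ultimately show ?thesis using that by blast
qed

text \<open>Equality in Cauchy-Schwarz puts \<open>moebius x y\<close> on the diameter through
  \<open>moebius x (-z)\<close>, and the inverse \<open>moebius (-x)\<close> takes this diameter
  into a geodesic, the one through \<open>-x\<close> and \<open>-z\<close>.\<close>

lemma geodesic_of_aligned:
  fixes x z :: "real ^ 'n"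
  assumes "norm x < 1" "norm z < 1" "x \<noteq> z"
  obtains \<gamma> where "hyperbolic_geodesic \<gamma>"
    "\<And>y. norm y < 1 \<Longrightarrow> (moebius x y \<bullet> moebius x (-z))\<^sup>2 = (norm (moebius x y) * norm (moebius x (-z)))\<^sup>2 \<Longrightarrow> y \<in> \<gamma>"
proof -
  define b where "b = moebius x (-z)"
  have "b \<noteq> 0"
  proof
    assume "b = 0"
    then have "moebius (-x) 0 = -z"
      using moebius_inverse[of x "-z"] assms by (simp add: b_def)
    then show False using assms by (simp add: moebius_def)
  qed
  define u where "u = sgn b"
  have u: "norm u = 1" using \<open>b \<noteq> 0\<close> by (simp add: u_def norm_sgn)
  have bu: "b = norm b *\<^sub>R u" using \<open>b \<noteq> 0\<close> by (simp add: u_def sgn_div_norm)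
  obtain \<gamma> where g: "hyperbolic_geodesic \<gamma>" "\<And>t. \<bar>t\<bar> < 1 \<Longrightarrow> moebius (-x) (t *\<^sub>R u) \<in> \<gamma>"
    using geodesic_through_moebius_diameter[of "-x" u] assms u by auto
  have "y \<in> \<gamma>" if y: "norm y < 1" "(moebius x y \<bullet> b)\<^sup>2 = (norm (moebius x y) * norm b)\<^sup>2" for y
  proof -
    define a where "a = moebius x y"
    have a1: "norm a < 1" unfolding a_def using assms y norm_moebius_less_1 by blast
    define t where "t = a \<bullet> u"
    have "(a \<bullet> b)\<^sup>2 = (t * norm b)\<^sup>2" by (subst bu) (simp add: t_def mult.commute)
    with y(2) have t2: "t\<^sup>2 = (norm a)\<^sup>2"
      using \<open>b \<noteq> 0\<close> by (simp add: a_def[symmetric] power_mult_distrib)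
    have "u \<bullet> u = 1" using u by (simp add: dot_square_norm)
    then have "(norm (a - t *\<^sub>R u))\<^sup>2 = (norm a)\<^sup>2 - 2 * t * t + t\<^sup>2"
      unfolding dot_square_norm[symmetric]
      by (simp add: inner_diff_left inner_diff_right inner_commute[of u a] power2_eq_square flip: t_def)
    then have "a = t *\<^sub>R u" using t2 by (simp add: power2_eq_square)
    moreover have "\<bar>t\<bar> < 1" using t2 a1 by (metis power2_eq_iff abs_norm_cancel abs_minus_cancel)
    ultimately have "moebius (-x) a \<in> \<gamma>" using g by auto
    then show ?thesis using moebius_inverse[of x y] assms y by (simp add: a_def)
  qed
  then show ?thesis using that g by (simp add: b_def)
qed

section \<open>The gradient of the radial potential\<close>

text \<open>Away from 0 the field is a composition of continuous maps; at 0 its norm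
  \<open>|g (|y|)|\<close> tends to \<open>g 0 = 0\<close>.\<close>

lemma continuous_on_radial_field:
  fixes g :: "real \<Rightarrow> real"
  assumes g: "continuous_on {0..<1} g" "g 0 = 0"
  shows "continuous_on (ball (0 :: real ^ 'n) 1) (radial_field g)"
proof -
  let ?B = "ball (0 :: real ^ 'n) 1"
  have gn: "continuous_on ?B (\<lambda>y. g (norm y))"
    by (rule continuous_on_compose2[OF g(1)]) (auto intro: continuous_intros)
  have nrm: "norm (radial_field g y) = \<bar>g (norm y)\<bar>" for y :: "real ^ 'n"
    using g by (simp add: radial_field_def abs_mult)
  have "continuous_on (?B - {0}) (\<lambda>y. g (norm y) *\<^sub>R (y /\<^sub>R norm y))"
    by (intro continuous_intros continuous_on_subset[OF gn]) auto
  then have "continuous_on (?B - {0}) (radial_field g)"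
    by (rule continuous_on_eq) (auto simp: radial_field_def)
  then have away: "isCont (radial_field g) y" if "y \<in> ?B" "y \<noteq> 0" for y
    using that by (simp add: continuous_on_eq_continuous_at open_Diff)
  have "isCont (\<lambda>y. g (norm y)) (0 :: real ^ 'n)"
    using gn by (simp add: continuous_on_eq_continuous_at)
  then have "((\<lambda>y. norm (radial_field g y)) \<longlongrightarrow> 0) (at (0 :: real ^ 'n))"
    unfolding nrm isCont_def using g by (simp add: tendsto_rabs_zero)
  then have "isCont (radial_field g) (0 :: real ^ 'n)"
    by (simp add: isCont_def tendsto_norm_zero_iff radial_field_def[where y=0])
  with away have "isCont (radial_field g) y" if "y \<in> ?B" for y
    using that by (cases "y = 0") auto
  then show ?thesis by (simp add: continuous_at_imp_continuous_on)
qed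

lemma continuous_on_moebius:
  "continuous_on (ball 0 1 \<times> cball 0 1) (\<lambda>(x, y). moebius x y)"
proof -
  have "\<forall>z \<in> ball 0 1 \<times> cball (0 :: real ^ 'n) 1. 1 + 2 * (fst z \<bullet> snd z) + (norm (fst z))\<^sup>2 * (norm (snd z))\<^sup>2 \<noteq> 0"
  proof
    fix z :: "(real ^ 'n) \<times> (real ^ 'n)" assume "z \<in> ball 0 1 \<times> cball 0 1"
    then show "1 + 2 * (fst z \<bullet> snd z) + (norm (fst z))\<^sup>2 * (norm (snd z))\<^sup>2 \<noteq> 0"
      using mden_pos[of "fst z" "snd z"] by (auto simp: mem_Times_iff mden_def)
  qed
  then show ?thesis
    unfolding moebius_def split_beta by (intro continuous_intros)
qed

lemma continuous_on_field:
  assumes "continuous_on {0..<1} g" "g 0 = 0"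
  shows "continuous_on (ball 0 1 \<times> ball 0 1) (\<lambda>(x, y). radial_field g (moebius x y :: real ^ 'n))"
  unfolding split_beta
proof (rule continuous_on_compose2[OF continuous_on_radial_field[OF assms]])
  show "continuous_on (ball 0 1 \<times> ball 0 1) (\<lambda>p. moebius (fst p) (snd p) :: real ^ 'n)"
    by (rule continuous_on_subset[OF continuous_on_moebius[unfolded split_beta]]) auto
qed (auto simp: norm_moebius_less_1)

lemma continuous_on_field_right:
  assumes "continuous_on {0..<1} g" "g 0 = 0" "norm x < 1"
  shows "continuous_on (ball 0 1) (\<lambda>y. radial_field g (moebius x y :: real ^ 'n))"
proof -
  have 1: "continuous_on (ball (0 :: real ^ 'n) 1) (Pair x)" by (intro continuous_intros)
  have 2: "Pair x ` ball (0 :: real ^ 'n) 1 \<subseteq> ball 0 1 \<times> ball 0 1" using assms by auto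
  show ?thesis
    using continuous_on_compose2[OF continuous_on_field[OF assms(1,2)] 1 2] by simp
qed

lemma moebius_differentiable:
  assumes "norm x < 1" "norm y \<le> 1"
  shows "(\<lambda>x. moebius x y) differentiable (at x)"
proof -
  have "mden x y \<noteq> 0" using mden_pos[OF assms] by simp
  then show ?thesis
    unfolding moebius_def mden_def dot_square_norm[symmetric] by (intro derivative_intros) auto
qed

text \<open>The component of the derivative along \<open>moebius x y\<close> is half the derivative
  of its squared norm. It is read off from the closed form of \<open>1 - |moebius x y|^2\<close>, so
  the full Jacobian is never computed.\<close>

lemma moebius_derivative_inner:
  assumes x: "norm x < 1" and y: "norm y < 1"
    and D: "((\<lambda>x. moebius x y) has_derivative D) (at x)"
  shows "moebius x y \<bullet> D h = (1 - (norm (moebius x y))\<^sup>2) / (1 - (norm x)\<^sup>2) * (moebius x y \<bullet> h)"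
proof -
  define X Y s where d: "X = (norm x)\<^sup>2" "Y = (norm y)\<^sup>2" "s = x \<bullet> y"
  have m: "mden x y > 0" using x y by (auto intro!: mden_pos)
  have X: "X < 1" using x norm_sq_less_1 by (auto simp: d)
  have "((\<lambda>x. (moebius x y \<bullet> moebius x y)) has_derivative (\<lambda>h. moebius x y \<bullet> D h + D h \<bullet> moebius x y)) (at x)"
    by (rule has_derivative_inner[OF D D])
  then have d1: "((\<lambda>x. 1 - (norm (moebius x y))\<^sup>2) has_derivative (\<lambda>h. - 2 * (moebius x y \<bullet> D h))) (at x)"
    unfolding dot_square_norm[symmetric]
    by (rule has_derivative_eq_rhs[OF has_derivative_diff[OF has_derivative_const]]) (auto simp: inner_commute)
  have mder: "((\<lambda>x. mden x y) has_derivative (\<lambda>h. 2 * (y \<bullet> h) + 2 * (x \<bullet> h) * Y)) (at x)"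
    unfolding mden_def dot_square_norm[symmetric] d
    by (auto intro!: derivative_eq_intros simp: inner_commute algebra_simps)
  have d2: "((\<lambda>x. (1 - (norm x)\<^sup>2) * (1 - (norm y)\<^sup>2) / mden x y) has_derivative
     (\<lambda>h. (- 2 * (x \<bullet> h) * (1 - Y) * mden x y - (1 - X) * (1 - Y) * (2 * (y \<bullet> h) + 2 * (x \<bullet> h) * Y)) / (mden x y)\<^sup>2)) (at x)"
  proof (rule has_derivative_eq_rhs[OF has_derivative_divide'[OF _ mder]])
    show "((\<lambda>x. (1 - (norm x)\<^sup>2) * (1 - (norm y)\<^sup>2)) has_derivative (\<lambda>h. - 2 * (x \<bullet> h) * (1 - Y))) (at x)"
      unfolding dot_square_norm[symmetric] d
      by (auto intro!: derivative_eq_intros simp: inner_commute)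
  qed (use m in \<open>auto simp: d power2_eq_square\<close>)
  have d3: "((\<lambda>x. 1 - (norm (moebius x y))\<^sup>2) has_derivative
     (\<lambda>h. (- 2 * (x \<bullet> h) * (1 - Y) * mden x y - (1 - X) * (1 - Y) * (2 * (y \<bullet> h) + 2 * (x \<bullet> h) * Y)) / (mden x y)\<^sup>2)) (at x)"
  proof (rule has_derivative_transform_within_open[OF d2, of "ball 0 1"])
    fix x' assume "x' \<in> ball (0 :: real ^ 'a) 1"
    then have "mden x' y > 0" using y by (auto intro!: mden_pos)
    then show "(1 - (norm x')\<^sup>2) * (1 - (norm y)\<^sup>2) / mden x' y = 1 - (norm (moebius x' y))\<^sup>2"
      by (simp add: one_minus_norm_moebius_sq)
  qed (use x in auto)
  have "- 2 * (moebius x y \<bullet> D h) = (- 2 * (x \<bullet> h) * (1 - Y) * mden x y - (1 - X) * (1 - Y) * (2 * (y \<bullet> h) + 2 * (x \<bullet> h) * Y)) / (mden x y)\<^sup>2"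
    using fun_cong[OF has_derivative_unique[OF d1 d3]] .
  also have "\<dots> = - 2 * ((1 - Y) * ((1 + 2 * s + Y) * (x \<bullet> h) + (1 - X) * (y \<bullet> h))) / (mden x y)\<^sup>2"
  proof (rule arg_cong[where f="\<lambda>w. w / _"])
    have "mden x y = 1 + 2 * s + X * Y" by (simp add: mden_def d)
    then show "- 2 * (x \<bullet> h) * (1 - Y) * mden x y - (1 - X) * (1 - Y) * (2 * (y \<bullet> h) + 2 * (x \<bullet> h) * Y)
       = - 2 * ((1 - Y) * ((1 + 2 * s + Y) * (x \<bullet> h) + (1 - X) * (y \<bullet> h)))"
      by (simp only:) (simp add: algebra_simps)
  qed
  also have "\<dots> = - 2 * ((1 - Y) / mden x y * (moebius x y \<bullet> h))"
    by (simp add: moebius_inner_left power2_eq_square d)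
  finally have "moebius x y \<bullet> D h = (1 - Y) / mden x y * (moebius x y \<bullet> h)" by simp
  then show ?thesis using m X by (simp add: one_minus_norm_moebius_sq d)
qed

text \<open>The weight \<open>1 / (1 - r^2)\<close> is there to cancel the factor
  \<open>1 - |moebius x y|^2\<close> of \<open>moebius_derivative_inner\<close>.\<close>

definition radial_potential :: "(real \<Rightarrow> real) \<Rightarrow> real \<Rightarrow> real" where
  "radial_potential g \<rho> = integral {0..\<rho>} (\<lambda>r. g r / (1 - r\<^sup>2))"

text \<open>Stated on a closed interval so as to include the one-sided derivative at 0, from which
  differentiability at the origin follows.\<close>

lemma radial_potential_has_derivative_within:
  assumes g: "continuous_on {0..<1} g" and t: "0 \<le> t" "t \<le> b" "b < 1"
  shows "(radial_potential g has_real_derivative g t / (1 - t\<^sup>2)) (at t within {0..b})"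
proof -
  have "1 - r\<^sup>2 \<noteq> 0" if "r \<in> {0..b}" for r
    using that t abs_square_less_1[of r] by auto
  then have "continuous_on {0..b} (\<lambda>r. g r / (1 - r\<^sup>2))"
    using t by (intro continuous_intros continuous_on_subset[OF g]) auto
  then show ?thesis
    using integral_has_real_derivative[of 0 b "\<lambda>r. g r / (1 - r\<^sup>2)" t] t
    by (simp add: radial_potential_def[abs_def])
qed

lemma radial_potential_has_derivative:
  assumes g: "continuous_on {0..<1} g" and t: "0 < t" "t < 1"
  shows "(radial_potential g has_real_derivative g t / (1 - t\<^sup>2)) (at t)"
proof -
  obtain b where b: "t < b" "b < 1" using t dense by blast
  then have "t \<in> interior {0..b}" using t by simp
  then have "at t within {0..b} = at t" by (rule at_within_interior)
  moreover have "(radial_potential g has_real_derivative g t / (1 - t\<^sup>2)) (at t within {0..b})"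
    using t b by (intro radial_potential_has_derivative_within[OF g]) auto
  ultimately show ?thesis by (simp only:)
qed

lemma radial_potential_norm_has_derivative:
  fixes w :: "real ^ 'n"
  assumes g: "continuous_on {0..<1} g" "g 0 = 0" and w: "norm w < 1"
  shows "((\<lambda>w. radial_potential g (norm w)) has_derivative (\<lambda>h. (radial_field g w \<bullet> h) / (1 - (norm w)\<^sup>2))) (at w)"
proof (cases "w = 0")
  case False
  have "((\<lambda>w. radial_potential g (norm w)) has_derivative (\<lambda>h. g (norm w) / (1 - (norm w)\<^sup>2) * (h \<bullet> sgn w))) (at w)"
    using has_derivative_compose[OF has_derivative_norm[OF False], of "radial_potential g" "(*) (g (norm w) / (1 - (norm w)\<^sup>2))"]
      radial_potential_has_derivative[OF g(1), of "norm w"] False w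
    by (simp add: has_field_derivative_def)
  moreover have "(\<lambda>h. g (norm w) / (1 - (norm w)\<^sup>2) * (h \<bullet> sgn w)) = (\<lambda>h. (radial_field g w \<bullet> h) / (1 - (norm w)\<^sup>2))"
    using False by (auto simp: radial_field_def sgn_div_norm inner_commute)
  ultimately show ?thesis by simp
next
  case True
  \<comment> \<open>The norm is not differentiable at 0, but \<open>g 0 = 0\<close> gives the
    potential slope 0 there, so the difference quotient by \<open>norm y\<close> vanishes in the
    limit.\<close>
  have "(radial_potential g has_real_derivative 0) (at 0 within {0..1/2})"
    using radial_potential_has_derivative_within[OF g(1), of 0 "1/2"] g by simp
  then have *: "((\<lambda>y. (radial_potential g y - radial_potential g 0) / y) \<longlongrightarrow> 0) (at 0 within {0..1/2})"
    by (simp add: has_field_derivative_iff)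
  have lim: "filterlim norm (at 0 within {0..1/2}) (at (0 :: real ^ 'n))"
    unfolding filterlim_at
  proof
    show "((norm :: real ^ 'n \<Rightarrow> real) \<longlongrightarrow> 0) (at 0)" by (simp add: tendsto_norm_zero_iff)
    show "\<forall>\<^sub>F x in at (0 :: real ^ 'n). norm x \<in> {0..1/2} \<and> norm x \<noteq> 0"
      unfolding eventually_at by (rule exI[of _ "1/2"]) auto
  qed
  have "((\<lambda>y. (radial_potential g (norm y) - radial_potential g 0) / norm y) \<longlongrightarrow> 0) (at (0 :: real ^ 'n))"
    by (rule filterlim_compose[OF * lim])
  then have "((\<lambda>y. norm ((radial_potential g (norm y) - radial_potential g 0) / norm y)) \<longlongrightarrow> 0) (at (0 :: real ^ 'n))"
    by (rule tendsto_norm_zero)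
  then show ?thesis
    unfolding True by (simp add: has_derivative_at radial_field_def)
qed

text \<open>The field is a scalar multiple of \<open>moebius x y\<close>, so the chain rule needs
  only the component given by \<open>moebius_derivative_inner\<close>.\<close>

lemma radial_potential_moebius_has_derivative:
  fixes x y :: "real ^ 'n"
  assumes g: "continuous_on {0..<1} g" "g 0 = 0" and x: "norm x < 1" and y: "norm y < 1"
  shows "((\<lambda>x. radial_potential g (norm (moebius x y))) has_derivative
     (\<lambda>h. (radial_field g (moebius x y) \<bullet> h) / (1 - (norm x)\<^sup>2))) (at x)"
proof -
  define w where "w = moebius x y"
  have w1: "norm w < 1" unfolding w_def using x y by (rule norm_moebius_less_1)
  then have "(norm w)\<^sup>2 < 1" by (rule norm_sq_less_1)
  have "norm y \<le> 1" using y by simp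
  from moebius_differentiable[OF x this]
  obtain D where D: "((\<lambda>x. moebius x y) has_derivative D) (at x)"
    unfolding differentiable_def by blast
  have "w \<bullet> D h = (1 - (norm w)\<^sup>2) / (1 - (norm x)\<^sup>2) * (w \<bullet> h)" for h
    unfolding w_def by (rule moebius_derivative_inner[OF x y D])
  then have "(radial_field g w \<bullet> D h) / (1 - (norm w)\<^sup>2) = (radial_field g w \<bullet> h) / (1 - (norm x)\<^sup>2)" for h
    using \<open>(norm w)\<^sup>2 < 1\<close> by (simp add: radial_field_def)
  then show ?thesis
    using has_derivative_compose[OF D radial_potential_norm_has_derivative[OF g w1[unfolded w_def]]]
    by (simp add: w_def)
qed

section \<open>Energy minimisation\<close>

lemma compact_subset_ball_imp_cball:
  fixes K :: "'a::euclidean_space set"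
  assumes "compact K" "K \<subseteq> ball 0 1"
  obtains R where "0 \<le> R" "R < 1" "K \<subseteq> cball 0 R"
proof (cases "K = {}")
  case False
  obtain k where "k \<in> K" "\<And>y. y \<in> K \<Longrightarrow> norm y \<le> norm k"
    using continuous_attains_sup[OF assms(1) False, of norm] by (auto intro: continuous_intros)
  then show ?thesis using assms by (intro that[of "norm k"]) auto
qed (use that[of 0] in auto)

text \<open>Lets the uniqueness hypotheses imply existence: near 1, \<open>g\<close> stays above a
  positive constant, and \<open>1 / (1 - r^2)\<close> is not integrable there.\<close>

lemma radial_potential_at_top:
  assumes g: "continuous_on {0..<1} g" "mono_on {0..<1} g" "\<And>r. 0 < r \<Longrightarrow> r < 1 \<Longrightarrow> 0 < g r"
  shows "filterlim (radial_potential g) at_top (at_left 1)"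
proof -
  \<comment> \<open>For \<open>t \<ge> 1/2\<close> one has
    \<open>g t \<ge> 2 * c \<ge> c * (1 + t)\<close>, hence
    \<open>g t / (1 - t^2) \<ge> c / (1 - t)\<close>. So \<open>f\<close> is nondecreasing, and the
    potential grows at least like \<open>- c * ln (1 - \<rho>)\<close>.\<close>
  define c where "c = g (1/2) / 2"
  have c: "0 < c" using g(3)[of "1/2"] by (simp add: c_def)
  define f where "f \<rho> = radial_potential g \<rho> + c * ln (1 - \<rho>)" for \<rho>
  have le: "f (1/2) \<le> f \<rho>" if \<rho>: "1/2 < \<rho>" "\<rho> < 1" for \<rho>
  proof (rule DERIV_nonneg_imp_nondecreasing[where f = f and a = "1/2" and b = \<rho>])
    show "1/2 \<le> \<rho>" using \<rho> by simp
    fix t assume t: "1/2 \<le> t" "t \<le> \<rho>"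
    have t2: "t\<^sup>2 < 1" using t \<rho> by (simp add: abs_square_less_1)
    have "(f has_real_derivative g t / (1 - t\<^sup>2) + c * (- 1 / (1 - t))) (at t)"
      unfolding f_def
    proof (intro DERIV_add DERIV_cmult)
      show "(radial_potential g has_real_derivative g t / (1 - t\<^sup>2)) (at t)"
        using t \<rho> by (intro radial_potential_has_derivative[OF g(1)]) auto
      show "((\<lambda>\<rho>. ln (1 - \<rho>)) has_real_derivative - 1 / (1 - t)) (at t)"
        using t \<rho> by (auto intro!: derivative_eq_intros)
    qed
    moreover have "c * (1 / (1 - t)) \<le> g t / (1 - t\<^sup>2)"
    proof -
      have "2 * c \<le> g t" using mono_onD[OF g(2), of "1/2" t] t \<rho> by (simp add: c_def)
      moreover have "c * (1 + t) \<le> c * 2" using c t \<rho> by (intro mult_left_mono) auto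
      ultimately have "c * (1 + t) \<le> g t" by simp
      moreover have "c * (1 / (1 - t)) = c * (1 + t) / (1 - t\<^sup>2)"
        using t \<rho> t2 by (simp add: divide_simps) (simp add: power2_eq_square algebra_simps)
      ultimately show ?thesis using t2 by (simp add: divide_right_mono)
    qed
    ultimately show "\<exists>y. (f has_real_derivative y) (at t) \<and> 0 \<le> y"
      by (intro exI[of _ "g t / (1 - t\<^sup>2) + c * (- 1 / (1 - t))"]) simp
  qed
  have "filterlim (\<lambda>\<rho>. ln (1 - \<rho>)) at_bot (at_left (1::real))"
    by (rule filterlim_compose[OF ln_at_0]) (auto simp: filterlim_at eventually_at_filter intro!: tendsto_eq_intros)
  then have "filterlim (\<lambda>\<rho>. c * ln (1 - \<rho>)) at_bot (at_left (1::real))"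
    by (rule filterlim_tendsto_pos_mult_at_bot[OF tendsto_const c])
  then have "filterlim (\<lambda>\<rho>. f (1/2) + - (c * ln (1 - \<rho>))) at_top (at_left (1::real))"
    by (intro filterlim_tendsto_add_at_top[OF tendsto_const]) (simp add: filterlim_uminus_at_top)
  then show ?thesis
  proof (rule filterlim_at_top_mono)
    have "\<forall>\<^sub>F \<rho> in at_left 1. \<rho> \<in> {1/2<..<(1::real)}"
      by (rule eventually_at_leftI[of "1/2"]) auto
    then show "\<forall>\<^sub>F \<rho> in at_left 1. f (1/2) + - (c * ln (1 - \<rho>)) \<le> radial_potential g \<rho>"
      by eventually_elim (use le in \<open>force simp: f_def\<close>)
  qed
qed

text \<open>Compact support is recorded as an almost everywhere bound by a radius
  \<open>R < 1\<close>, which can be shared by a whole sequence of measures.\<close>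

locale mass_on_ball = finite_measure M for M :: "(real ^ 'n) measure" +
  fixes R :: real and g :: "real \<Rightarrow> real"
  assumes borel: "borel_measure_on_ball M"
    and R: "0 \<le> R" "R < 1"
    and supp: "AE y in M. norm y \<le> R"
    and mass: "0 < measure M (space M)"
    and g: "continuous_on {0..<1} g" "g 0 = 0"
begin

lemma space_eq: "space M = ball 0 1"
proof -
  have "space M = space (restrict_space borel (ball (0 :: real ^ 'n) 1))"
    using borel unfolding borel_measure_on_ball_def by (rule sets_eq_imp_space_eq)
  then show ?thesis by (simp add: space_restrict_space)
qed

lemma measurable_continuous:
  fixes f :: "real ^ 'n \<Rightarrow> 'b::topological_space"
  assumes "continuous_on (ball 0 1) f"
  shows "f \<in> borel_measurable M"
proof -
  have "borel_measurable M = (borel_measurable (restrict_space borel (ball 0 1)) :: (_ \<Rightarrow> 'b) set)"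
    using borel unfolding borel_measure_on_ball_def by (intro measurable_cong_sets) auto
  then show ?thesis using borel_measurable_continuous_on_restrict[OF assms] by simp
qed

text \<open>Such a function may blow up at the sphere, but it is bounded on
  \<open>cball 0 R\<close>, where the finite measure is concentrated.\<close>

lemma integrable_continuous:
  fixes f :: "real ^ 'n \<Rightarrow> 'b::{banach,second_countable_topology}"
  assumes f: "continuous_on (ball 0 1) f"
  shows "integrable M f"
proof -
  have "compact (f ` cball 0 R)"
    using R by (intro compact_continuous_image continuous_on_subset[OF f]) auto
  from compact_imp_bounded[OF this] obtain B where "\<forall>w \<in> f ` cball 0 R. norm w \<le> B"
    unfolding bounded_iff by blast
  then have "norm (f y) \<le> B" if "norm y \<le> R" for y using that by simp
  then show ?thesis
    using supp by (intro integrable_const_bound[of _ B] measurable_continuous f) auto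
qed

lemma continuous_field: "norm x < 1 \<Longrightarrow> continuous_on (ball 0 1) (\<lambda>y. radial_field g (moebius x y :: real ^ 'n))"
  by (rule continuous_on_field_right[OF g])

lemma V_field_inner:
  assumes "norm x < 1"
  shows "V_field g M x \<bullet> e = (\<integral>y. radial_field g (moebius x y) \<bullet> e \<partial>M)"
  unfolding V_field_def
  by (rule integral_inner_left[symmetric]) (intro integrable_continuous continuous_field assms)

lemma norm_integral_le:
  fixes f :: "real ^ 'n \<Rightarrow> real"
  assumes f: "integrable M f" and B: "\<And>y. norm y \<le> R \<Longrightarrow> norm (f y) \<le> B"
  shows "norm (\<integral>y. f y \<partial>M) \<le> B * measure M (space M)"
proof -
  have "norm (\<integral>y. f y \<partial>M) \<le> (\<integral>y. norm (f y) \<partial>M)" by (rule integral_norm_bound)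
  also have "\<dots> \<le> (\<integral>y. B \<partial>M)"
  proof (rule integral_mono_AE)
    show "AE y in M. norm (f y) \<le> B" using supp by eventually_elim (rule B)
  qed (use f in auto)
  finally show ?thesis by (simp add: mult.commute)
qed

lemma AE_not_False: "\<not> (AE y in M. False)"
  using mass by (auto simp: AE_iff_measurable[OF sets.top] measure_def)

definition energy :: "real ^ 'n \<Rightarrow> real" where
  "energy x = (\<integral>y. radial_potential g (norm (moebius x y)) \<partial>M)"

lemma continuous_potential:
  assumes "norm x < 1"
  shows "continuous_on (ball 0 1) (\<lambda>y. radial_potential g (norm (moebius x y :: real ^ 'n)))"
proof -
  have 0: "continuous_on (ball (0 :: real ^ 'n) 1) (\<lambda>w. radial_potential g (norm w))"
    by (intro continuous_at_imp_continuous_on ballI has_derivative_continuous[OF radial_potential_norm_has_derivative[OF g]]) auto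
  have 1: "continuous_on (ball (0 :: real ^ 'n) 1) (Pair x)" by (intro continuous_intros)
  have 2: "Pair x ` ball (0 :: real ^ 'n) 1 \<subseteq> ball 0 1 \<times> cball 0 1" using assms by auto
  have 3: "continuous_on (ball 0 1) (\<lambda>y. moebius x y)"
    using continuous_on_compose2[OF continuous_on_moebius 1 2] by simp
  show ?thesis
    by (rule continuous_on_compose2[OF 0 3]) (use assms norm_moebius_less_1 in auto)
qed

lemma integrable_potential:
  "norm x < 1 \<Longrightarrow> integrable M (\<lambda>y. radial_potential g (norm (moebius x y)))"
  by (intro integrable_continuous continuous_potential)

text \<open>The gradient is bounded on a compact product, and \<open>cball 0 S\<close> is convex. As
  \<open>B\<close> does not depend on \<open>y\<close>, it yields both continuity of the energy and
  a dominating constant for its difference quotients.\<close>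

lemma potential_lipschitz:
  assumes "0 \<le> S" "S < 1"
  obtains B where "0 \<le> B" "\<And>x x' y :: real ^ 'n. norm x \<le> S \<Longrightarrow> norm x' \<le> S \<Longrightarrow> norm y \<le> R \<Longrightarrow>
     \<bar>radial_potential g (norm (moebius x y)) - radial_potential g (norm (moebius x' y))\<bar> \<le> B * norm (x - x')"
proof -
  have "continuous_on (cball 0 S \<times> cball 0 R) (\<lambda>(x, y). radial_field g (moebius x y :: real ^ 'n))"
    using assms R by (intro continuous_on_subset[OF continuous_on_field[OF g]]) auto
  then have "compact ((\<lambda>(x, y). radial_field g (moebius x y :: real ^ 'n)) ` (cball 0 S \<times> cball 0 R))"
    by (intro compact_continuous_image compact_Times) auto
  from compact_imp_bounded[OF this] obtain C where "0 < C"
    "\<forall>w \<in> (\<lambda>(x, y). radial_field g (moebius x y :: real ^ 'n)) ` (cball 0 S \<times> cball 0 R). norm w \<le> C"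
    unfolding bounded_pos by blast
  then have C: "0 < C" "\<And>x y :: real ^ 'n. norm x \<le> S \<Longrightarrow> norm y \<le> R \<Longrightarrow> norm (radial_field g (moebius x y)) \<le> C"
    by auto
  have S2: "S\<^sup>2 < 1" using assms by (simp add: abs_square_less_1)
  have "\<bar>radial_potential g (norm (moebius x y)) - radial_potential g (norm (moebius x' y))\<bar> \<le> C / (1 - S\<^sup>2) * norm (x - x')"
    if x: "norm x \<le> S" "norm x' \<le> S" and y: "norm y \<le> R" for x x' y :: "real ^ 'n"
  proof -
    have "norm (radial_potential g (norm (moebius x y)) - radial_potential g (norm (moebius x' y))) \<le> C / (1 - S\<^sup>2) * norm (x - x')"
    proof (rule differentiable_bound[where S = "cball 0 S" and f' = "\<lambda>x h. (radial_field g (moebius x y) \<bullet> h) / (1 - (norm x)\<^sup>2)"])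
      fix z :: "real ^ 'n" assume "z \<in> cball 0 S"
      then have z: "norm z \<le> S" by simp
      then have z2: "(norm z)\<^sup>2 \<le> S\<^sup>2" by (simp add: power_mono)
      show "((\<lambda>x. radial_potential g (norm (moebius x y))) has_derivative (\<lambda>h. (radial_field g (moebius z y) \<bullet> h) / (1 - (norm z)\<^sup>2))) (at z within cball 0 S)"
        by (rule has_derivative_at_withinI, rule radial_potential_moebius_has_derivative[OF g]) (use z assms y R in auto)
      show "onorm (\<lambda>h. (radial_field g (moebius z y) \<bullet> h) / (1 - (norm z)\<^sup>2)) \<le> C / (1 - S\<^sup>2)"
      proof (rule onorm_le)
        fix h :: "real ^ 'n"
        have "\<bar>radial_field g (moebius z y) \<bullet> h\<bar> \<le> norm (radial_field g (moebius z y)) * norm h"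
          by (rule Cauchy_Schwarz_ineq2)
        also have "\<dots> \<le> C * norm h" using C(2)[OF z y] by (intro mult_right_mono) auto
        finally have "\<bar>radial_field g (moebius z y) \<bullet> h\<bar> / (1 - (norm z)\<^sup>2) \<le> (C * norm h) / (1 - S\<^sup>2)"
          using z2 S2 C by (intro frac_le) auto
        then show "norm ((radial_field g (moebius z y) \<bullet> h) / (1 - (norm z)\<^sup>2)) \<le> C / (1 - S\<^sup>2) * norm h"
          using z2 S2 by simp
      qed
    qed (use x in auto)
    then show ?thesis by simp
  qed
  moreover have "0 \<le> C / (1 - S\<^sup>2)" using S2 C by simp
  ultimately show ?thesis using that by blast
qed

lemma continuous_energy:
  assumes "0 \<le> S" "S < 1"
  shows "continuous_on (cball 0 S) energy"
proof -
  obtain B where B: "0 \<le> B" "\<And>x x' y :: real ^ 'n. norm x \<le> S \<Longrightarrow> norm x' \<le> S \<Longrightarrow> norm y \<le> R \<Longrightarrow>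
     \<bar>radial_potential g (norm (moebius x y)) - radial_potential g (norm (moebius x' y))\<bar> \<le> B * norm (x - x')"
    using potential_lipschitz[OF assms] by metis
  have "(B * measure M (space M))-lipschitz_on (cball 0 S) energy"
  proof (rule lipschitz_onI)
    fix x x' :: "real ^ 'n" assume "x \<in> cball 0 S" "x' \<in> cball 0 S"
    then have x: "norm x \<le> S" "norm x' \<le> S" "norm x < 1" "norm x' < 1" using assms by auto
    have "energy x - energy x' = (\<integral>y. radial_potential g (norm (moebius x y)) - radial_potential g (norm (moebius x' y)) \<partial>M)"
      unfolding energy_def using x by (intro Bochner_Integration.integral_diff[symmetric] integrable_potential)
    also have "norm \<dots> \<le> B * norm (x - x') * measure M (space M)"
      using B x by (intro norm_integral_le Bochner_Integration.integrable_diff integrable_potential) auto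
    finally show "dist (energy x) (energy x') \<le> B * measure M (space M) * dist x x'"
      by (simp add: dist_norm mult_ac)
  qed (use B in auto)
  then show ?thesis by (rule lipschitz_on_continuous_on)
qed

text \<open>As \<open>x\<close> nears the sphere, \<open>moebius x y\<close> does so uniformly for
  \<open>|y| \<le> R\<close>, so the integrand eventually exceeds \<open>Z\<close> divided by the
  mass.\<close>

lemma energy_coercive:
  assumes lim: "filterlim (radial_potential g) at_top (at_left 1)"
  obtains S where "0 \<le> S" "S < 1" "\<And>x. S < norm x \<Longrightarrow> norm x < 1 \<Longrightarrow> Z \<le> energy x"
proof -
  let ?m = "measure M (space M)"
  have "\<forall>\<^sub>F \<rho> in at_left 1. Z / ?m \<le> radial_potential g \<rho>"
    using lim by (simp add: filterlim_at_top)
  then obtain b0 where b0: "b0 < 1" "\<And>\<rho>. b0 < \<rho> \<Longrightarrow> \<rho> < 1 \<Longrightarrow> Z / ?m \<le> radial_potential g \<rho>"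
    by (auto simp: eventually_at_left_field)
  \<comment> \<open>Nonnegativity of \<open>b\<close> permits comparing squares.\<close>
  define b where "b = max 0 b0"
  have b: "0 \<le> b" "b < 1" using b0 by (auto simp: b_def)
  then have b2: "b\<^sup>2 < 1" by (simp add: abs_square_less_1)
  \<comment> \<open>Chosen so that \<open>1 - |x|^2 < \<epsilon>\<close> implies
    \<open>1 - |moebius x y|^2 \<le> (1 - |x|^2) / (1 - R)^2 < 1 - b^2\<close>.\<close>
  define \<epsilon> where "\<epsilon> = (1 - b\<^sup>2) * (1 - R)\<^sup>2"
  have eps: "0 < \<epsilon>" "\<epsilon> \<le> 1"
  proof -
    show "0 < \<epsilon>" using b2 R by (simp add: \<epsilon>_def)
    have "(1 - b\<^sup>2) * (1 - R)\<^sup>2 \<le> 1 * 1"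
      using b2 R by (intro mult_mono) (auto simp: power_le_one)
    then show "\<epsilon> \<le> 1" by (simp add: \<epsilon>_def)
  qed
  show ?thesis
  proof (rule that[of "sqrt (1 - \<epsilon>)"])
    show "0 \<le> sqrt (1 - \<epsilon>)" "sqrt (1 - \<epsilon>) < 1" using eps by auto
    fix x :: "real ^ 'n" assume x: "sqrt (1 - \<epsilon>) < norm x" "norm x < 1"
    have "1 - \<epsilon> < (norm x)\<^sup>2"
      using x(1) eps by (metis norm_ge_zero real_less_lsqrt real_sqrt_less_iff real_sqrt_unique not_less_iff_gr_or_eq less_trans)
    then have x2: "1 - (norm x)\<^sup>2 < \<epsilon>" by simp
    have low: "Z / ?m \<le> radial_potential g (norm (moebius x y))" if y: "norm y \<le> R" for y
    proof -
      have y1: "norm y < 1" using y R by simp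
      have "norm x * norm y \<le> 1 * R" using x y by (intro mult_mono) auto
      then have "(1 - R)\<^sup>2 \<le> (1 - norm x * norm y)\<^sup>2" using R by (intro power_mono) auto
      also have "\<dots> \<le> mden x y" by (rule mden_lower)
      finally have D: "(1 - R)\<^sup>2 \<le> mden x y" .
      have D0: "0 < mden x y" using D R by (smt (verit) zero_less_power)
      have "1 - (norm (moebius x y))\<^sup>2 = (1 - (norm x)\<^sup>2) * (1 - (norm y)\<^sup>2) / mden x y"
        using D0 by (simp add: one_minus_norm_moebius_sq)
      also have "\<dots> \<le> (1 - (norm x)\<^sup>2) * 1 / (1 - R)\<^sup>2"
        using D R norm_sq_less_1[OF x(2)] norm_sq_less_1[OF y1] by (intro frac_le mult_left_mono) auto
      also have "\<dots> < \<epsilon> / (1 - R)\<^sup>2" using x2 R by (simp add: divide_strict_right_mono)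
      also have "\<dots> = 1 - b\<^sup>2" using R by (simp add: \<epsilon>_def)
      finally have "b < norm (moebius x y)" using b by (simp add: power2_less_imp_less)
      then show ?thesis
        using b0(2)[of "norm (moebius x y)"] norm_moebius_less_1[OF x(2) y1] by (simp add: b_def)
    qed
    have "(\<integral>y. Z / ?m \<partial>M) \<le> energy x"
      unfolding energy_def
    proof (rule integral_mono_AE)
      show "AE y in M. Z / ?m \<le> radial_potential g (norm (moebius x y))"
        using supp by eventually_elim (rule low)
    qed (use x in \<open>auto intro!: integrable_potential\<close>)
    then show "Z \<le> energy x" using mass by simp
  qed
qed

text \<open>One directional derivative is enough. Along \<open>e = - V(x)\<close> the difference
  quotients at a minimum are nonnegative, while their limit is
  \<open>- |V(x)|^2 / (1 - |x|^2)\<close>. A sequence of steps is taken to allow dominated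
  convergence.\<close>

lemma V_field_zero_if_energy_min:
  assumes x: "norm x < 1" and min: "\<And>z. norm z < 1 \<Longrightarrow> energy x \<le> energy z"
  shows "V_field g M x = 0"
proof -
  define e where "e = - V_field g M x"
  let ?P = "\<lambda>x y. radial_potential g (norm (moebius x y))"
  obtain S where S: "norm x < S" "S < 1" using x dense by blast
  then have S3: "0 \<le> S" by (smt (verit) norm_ge_zero)
  obtain B where B: "0 \<le> B" "\<And>x x' y :: real ^ 'n. norm x \<le> S \<Longrightarrow> norm x' \<le> S \<Longrightarrow> norm y \<le> R \<Longrightarrow>
     \<bar>?P x y - ?P x' y\<bar> \<le> B * norm (x - x')"
    using potential_lipschitz[OF S3 S(2)] by metis
  \<comment> \<open>Keeps \<open>x + t k *\<^sub>R e\<close> inside \<open>cball 0 S\<close>; the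
    summand 1 guards against \<open>e = 0\<close>.\<close>
  define \<delta> where "\<delta> = (S - norm x) / (1 + norm e)"
  have e1: "0 < 1 + norm e" by (simp add: add_pos_nonneg)
  have \<delta>: "0 < \<delta>" using S e1 by (simp add: \<delta>_def)
  define t where "t k = \<delta> * inverse (real (Suc k))" for k
  have t: "0 < t k" for k using \<delta> by (simp add: t_def)
  have t_le: "t k \<le> \<delta>" for k
    unfolding t_def using \<delta> by (intro mult_left_le) (auto simp: inverse_le_1_iff)
  have z: "norm (x + t k *\<^sub>R e) \<le> S" for k
  proof -
    have "t k * norm e \<le> \<delta> * (1 + norm e)" using t_le \<delta> by (intro mult_mono) auto
    also have "\<dots> = S - norm x" using e1 by (simp add: \<delta>_def)
    finally show ?thesis using norm_triangle_ineq[of x "t k *\<^sub>R e"] t[of k] by simp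
  qed
  have z1: "norm (x + t k *\<^sub>R e) < 1" for k using z[of k] S by simp
  have t_lim: "filterlim t (at 0) sequentially"
    unfolding filterlim_at
  proof
    show "t \<longlonglongrightarrow> 0" unfolding t_def using tendsto_mult[OF tendsto_const[of \<delta>] LIMSEQ_inverse_real_of_nat] by simp
    show "\<forall>\<^sub>F k in sequentially. t k \<in> UNIV \<and> t k \<noteq> 0" using t by (simp add: less_imp_neq[THEN not_sym])
  qed
  have pointwise: "(\<lambda>k. (?P (x + t k *\<^sub>R e) y - ?P x y) / t k) \<longlonglongrightarrow> (radial_field g (moebius x y) \<bullet> e) / (1 - (norm x)\<^sup>2)"
    if y: "norm y < 1" for y
  proof -
    have "((\<lambda>s. x + s *\<^sub>R e) has_derivative (\<lambda>s. s *\<^sub>R e)) (at 0)"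
      by (auto intro!: derivative_eq_intros)
    moreover have "((\<lambda>x. ?P x y) has_derivative (\<lambda>h. (radial_field g (moebius x y) \<bullet> h) / (1 - (norm x)\<^sup>2))) (at (x + 0 *\<^sub>R e))"
      using radial_potential_moebius_has_derivative[OF g x y] by simp
    ultimately have "((\<lambda>s. ?P (x + s *\<^sub>R e) y) has_derivative (\<lambda>s. (radial_field g (moebius x y) \<bullet> (s *\<^sub>R e)) / (1 - (norm x)\<^sup>2))) (at 0)"
      by (rule has_derivative_compose)
    then have "((\<lambda>s. ?P (x + s *\<^sub>R e) y) has_real_derivative ((radial_field g (moebius x y) \<bullet> e) / (1 - (norm x)\<^sup>2))) (at 0)"
      unfolding has_field_derivative_def by (rule has_derivative_eq_rhs) (auto simp: mult.commute)
    then have "((\<lambda>s. (?P (x + s *\<^sub>R e) y - ?P x y) / s) \<longlongrightarrow> (radial_field g (moebius x y) \<bullet> e) / (1 - (norm x)\<^sup>2)) (at 0)"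
      by (simp add: DERIV_def)
    then show ?thesis using t_lim by (rule filterlim_compose)
  qed
  have "(\<lambda>k. \<integral>y. (?P (x + t k *\<^sub>R e) y - ?P x y) / t k \<partial>M) \<longlonglongrightarrow> (\<integral>y. (radial_field g (moebius x y) \<bullet> e) / (1 - (norm x)\<^sup>2) \<partial>M)"
  proof (rule integral_dominated_convergence[where w = "\<lambda>_. B * norm e"])
    show "(\<lambda>y. radial_field g (moebius x y) \<bullet> e / (1 - (norm x)\<^sup>2)) \<in> borel_measurable M"
      using x norm_sq_less_1[OF x] by (intro measurable_continuous continuous_intros continuous_field) auto
    show "(\<lambda>y. (?P (x + t k *\<^sub>R e) y - ?P x y) / t k) \<in> borel_measurable M" for k
      using t[of k] x z1[of k] by (intro measurable_continuous continuous_intros continuous_potential) auto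
    show "AE y in M. (\<lambda>k. (?P (x + t k *\<^sub>R e) y - ?P x y) / t k) \<longlonglongrightarrow> (radial_field g (moebius x y) \<bullet> e) / (1 - (norm x)\<^sup>2)"
      using supp by eventually_elim (use R in \<open>auto intro: pointwise\<close>)
    show "AE y in M. norm ((?P (x + t k *\<^sub>R e) y - ?P x y) / t k) \<le> B * norm e" for k
      using supp
    proof eventually_elim
      fix y :: "real ^ 'n" assume "norm y \<le> R"
      then have "\<bar>?P (x + t k *\<^sub>R e) y - ?P x y\<bar> \<le> B * (t k * norm e)"
        using B(2)[OF z[of k], of x y] S t[of k] by simp
      then show "norm ((?P (x + t k *\<^sub>R e) y - ?P x y) / t k) \<le> B * norm e"
        using t[of k] by (simp add: divide_simps mult_ac)
    qed
  qed simp
  moreover have "0 \<le> (\<integral>y. (?P (x + t k *\<^sub>R e) y - ?P x y) / t k \<partial>M)" for k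
  proof -
    have "(\<integral>y. (?P (x + t k *\<^sub>R e) y - ?P x y) / t k \<partial>M) = (energy (x + t k *\<^sub>R e) - energy x) / t k"
      unfolding energy_def using integrable_potential[OF z1[of k]] integrable_potential[OF x] by simp
    then show ?thesis using min[OF z1[of k]] t[of k] by simp
  qed
  ultimately have "0 \<le> (\<integral>y. (radial_field g (moebius x y) \<bullet> e) / (1 - (norm x)\<^sup>2) \<partial>M)"
    by (intro LIMSEQ_le_const) auto
  also have "\<dots> = (V_field g M x \<bullet> e) / (1 - (norm x)\<^sup>2)"
    by (simp add: V_field_inner[OF x])
  finally have "0 \<le> V_field g M x \<bullet> e" using norm_sq_less_1[OF x] by (simp add: zero_le_divide_iff)
  then show ?thesis by (simp add: e_def dot_square_norm)
qed

lemma V_field_zero_exists: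
  assumes lim: "filterlim (radial_potential g) at_top (at_left 1)"
  shows "\<exists>x\<in>ball 0 1. V_field g M x = 0"
proof -
  \<comment> \<open>With the level \<open>energy 0\<close>, the minimum over
    \<open>cball 0 S\<close>, which contains 0, is also a minimum over the open ball.\<close>
  obtain S where S: "0 \<le> S" "S < 1" "\<And>x. S < norm x \<Longrightarrow> norm x < 1 \<Longrightarrow> energy 0 \<le> energy x"
    using energy_coercive[OF lim] by metis
  obtain x where x: "x \<in> cball 0 S" "\<And>z. z \<in> cball 0 S \<Longrightarrow> energy x \<le> energy z"
    using continuous_attains_inf[OF compact_cball _ continuous_energy[OF S(1,2)]] S(1) by auto
  have "energy x \<le> energy z" if "norm z < 1" for z
  proof (cases "norm z \<le> S")
    case False
    then have "energy 0 \<le> energy z" using S(3) that by simp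
    moreover have "energy x \<le> energy 0" using x(2) S(1) by simp
    ultimately show ?thesis by simp
  qed (use x in auto)
  then have "V_field g M x = 0" using x(1) S(2) by (intro V_field_zero_if_energy_min) auto
  then show ?thesis using x(1) S(2) by (intro bexI[of _ x]) auto
qed

end

section \<open>Uniqueness and continuous dependence\<close>

context mass_on_ball
begin

lemma V_field_zero_unique:
  assumes mono: "mono_on {0..<1} g"
    and strict: "strict_mono_on {0..<1} g \<or> (\<forall>r. 0 < r \<and> r < 1 \<longrightarrow> 0 < g r) \<and> not_supported_in_geodesic M"
    and x: "norm x < 1" "V_field g M x = 0" and z: "norm z < 1" "V_field g M z = 0"
  shows "x = z"
proof (rule ccontr)
  assume "x \<noteq> z"
  have cont: "continuous_on (ball 0 1) (angular_sum g x z)"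
    unfolding angular_sum_def[abs_def] using x z by (intro continuous_intros continuous_field) auto
  have "(\<integral>y. angular_sum g x z y \<partial>M) = V_field g M x \<bullet> sgn (moebius x (-z)) + V_field g M z \<bullet> sgn (moebius z (-x))"
    unfolding angular_sum_def V_field_inner[OF x(1)] V_field_inner[OF z(1)]
    using x z by (intro Bochner_Integration.integral_add integrable_continuous continuous_intros continuous_field) auto
  then have "(\<integral>y. angular_sum g x z y \<partial>M) = 0" using x z by simp
  moreover have pos: "AE y in M. 0 \<le> angular_sum g x z y"
    using angular_sum_pos(1)[OF x(1) _ z(1) \<open>x \<noteq> z\<close> mono g(2)] space_eq by (intro AE_I2) auto
  ultimately have zero: "AE y in M. angular_sum g x z y = 0"
    using integral_nonneg_eq_0_iff_AE[OF integrable_continuous[OF cont]] by simp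
  show False
  proof (cases "strict_mono_on {0..<1} g")
    case True
    have "AE y in M. False"
      using zero AE_space
    proof eventually_elim
      fix y assume "y \<in> space M" "angular_sum g x z y = 0"
      then show False
        using angular_sum_pos(2)[OF x(1) _ z(1) \<open>x \<noteq> z\<close> mono g(2), of y] True space_eq by auto
    qed
    then show False using AE_not_False by simp
  next
    case False
    then have gpos: "\<forall>r. 0 < r \<and> r < 1 \<longrightarrow> 0 < g r" and ns: "not_supported_in_geodesic M"
      using strict by auto
    obtain \<gamma> where \<gamma>: "hyperbolic_geodesic \<gamma>"
      "\<And>y. norm y < 1 \<Longrightarrow> (moebius x y \<bullet> moebius x (-z))\<^sup>2 = (norm (moebius x y) * norm (moebius x (-z)))\<^sup>2 \<Longrightarrow> y \<in> \<gamma>"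
      using geodesic_of_aligned[OF x(1) z(1) \<open>x \<noteq> z\<close>] by metis
    have "AE y in M. y \<in> \<gamma>"
      using zero AE_space
    proof eventually_elim
      fix y assume "y \<in> space M" "angular_sum g x z y = 0"
      then show "y \<in> \<gamma>"
        using angular_sum_pos(2)[OF x(1) _ z(1) \<open>x \<noteq> z\<close> mono g(2), of y] gpos \<gamma>(2)[of y] space_eq by auto
    qed
    moreover have "0 < emeasure M (ball 0 1 - \<gamma>)"
      using ns \<gamma>(1) by (simp add: not_supported_in_geodesic_def)
    \<comment> \<open>A non-measurable set gets the value 0, so positivity already shows that the
      complement of \<open>\<gamma>\<close> is measurable.\<close>
    moreover from this have "ball 0 1 - \<gamma> \<in> sets M"
      by (metis emeasure_notin_sets less_irrefl)
    ultimately show False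
      using AE_iff_measurable[of "ball 0 1 - \<gamma>" M "\<lambda>y. y \<in> \<gamma>"] space_eq by (auto simp: set_diff_eq)
  qed
qed

end

section \<open>Continuous dependence of the zero on the measure\<close>

lemma moebius_outward:
  assumes R: "0 \<le> R" "R < 1"
  obtains S where "0 \<le> S" "S < 1"
    "\<And>x y :: real ^ 'n. S < norm x \<Longrightarrow> norm x < 1 \<Longrightarrow> norm y \<le> R \<Longrightarrow> 0 < moebius x y \<bullet> x"
proof -
  \<comment> \<open>\<open>q\<close> bounds \<open>1 + 2 (x \<bullet> y) + |y|^2\<close> from below,
    so the numerator of \<open>moebius x y \<bullet> x\<close> is at least
    \<open>q |x|^2 - (1 - |x|^2)\<close>, which is positive once
    \<open>|x|^2 > 1 / (1 + q)\<close>.\<close>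
  define q where "q = (1 - R)\<^sup>2"
  have q: "0 < q" using R by (simp add: q_def)
  show ?thesis
  proof (rule that[of "sqrt (1 / (1 + q))"])
    show "0 \<le> sqrt (1 / (1 + q))" "sqrt (1 / (1 + q)) < 1" using q by (auto simp: real_sqrt_divide)
    fix x y :: "real ^ 'n"
    assume x: "sqrt (1 / (1 + q)) < norm x" "norm x < 1" and y: "norm y \<le> R"
    have "1 / (1 + q) < (norm x)\<^sup>2" using x(1) q by (metis norm_ge_zero real_sqrt_less_iff real_sqrt_unique)
    then have x2: "0 < q * (norm x)\<^sup>2 - (1 - (norm x)\<^sup>2)" using q by (simp add: field_simps)
    have "norm x * norm y \<le> norm y" using x by (simp add: mult_left_le_one_le)
    then have xy: "- norm y \<le> x \<bullet> y" using Cauchy_Schwarz_ineq2[of x y] by linarith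
    have "q \<le> (1 - norm y)\<^sup>2" unfolding q_def using y R by (intro power_mono) auto
    also have "\<dots> \<le> 1 + 2 * (x \<bullet> y) + (norm y)\<^sup>2" using xy by (simp add: power2_diff)
    finally have "q * (norm x)\<^sup>2 \<le> (1 + 2 * (x \<bullet> y) + (norm y)\<^sup>2) * (norm x)\<^sup>2" by (intro mult_right_mono) auto
    moreover have "(1 - (norm x)\<^sup>2) * (-1) \<le> (1 - (norm x)\<^sup>2) * (x \<bullet> y)"
      using xy y R norm_sq_less_1[OF x(2)] by (intro mult_left_mono) auto
    ultimately have "0 < (1 + 2 * (x \<bullet> y) + (norm y)\<^sup>2) * (x \<bullet> x) + (1 - (norm x)\<^sup>2) * (y \<bullet> x)"
      using x2 by (simp add: dot_square_norm inner_commute[of y x])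
    then show "0 < moebius x y \<bullet> x"
      unfolding moebius_inner_left using mden_pos[OF x(2), of y] y R by simp
  qed
qed

text \<open>As \<open>g > 0\<close>, the field is a positive multiple of \<open>moebius x y\<close>,
  so \<open>V(x) \<bullet> x\<close> integrates an almost everywhere positive function against a
  nonzero measure.\<close>

lemma (in mass_on_ball) V_field_nonzero_if_outward:
  assumes gpos: "\<And>r. 0 < r \<Longrightarrow> r < 1 \<Longrightarrow> 0 < g r"
    and x: "norm x < 1" and out: "\<And>y. norm y \<le> R \<Longrightarrow> 0 < moebius x y \<bullet> x"
  shows "V_field g M x \<noteq> 0"
proof
  assume V0: "V_field g M x = 0"
  let ?f = "\<lambda>y. radial_field g (moebius x y) \<bullet> x"
  have pos: "AE y in M. 0 < ?f y"
    using supp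
  proof eventually_elim
    fix y :: "real ^ 'n" assume y: "norm y \<le> R"
    then have "0 < moebius x y \<bullet> x" by (rule out)
    moreover from this have "moebius x y \<noteq> 0" by auto
    moreover have "norm (moebius x y) < 1" using y R x by (intro norm_moebius_less_1) auto
    ultimately show "0 < ?f y" using gpos by (simp add: radial_field_def)
  qed
  have "(\<integral>y. ?f y \<partial>M) = 0" using V_field_inner[OF x, of x] V0 by simp
  moreover have "integrable M ?f" using x by (intro integrable_continuous continuous_intros continuous_field)
  moreover have "AE y in M. 0 \<le> ?f y" using pos by eventually_elim simp
  ultimately have "AE y in M. ?f y = 0" using integral_nonneg_eq_0_iff_AE by blast
  with pos have "AE y in M. False" by eventually_elim simp
  then show False using AE_not_False by simp
qed

text \<open>With \<open>e\<close> the limiting field at \<open>l\<close>, the numbers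
  \<open>V_field g (N k) l \<bullet> e\<close> have two limits: \<open>|e|^2\<close> by weak
  convergence, and 0 because the field of \<open>N k\<close> vanishes at the nearby point
  \<open>z k\<close>, the integrand is uniformly continuous and the masses are bounded.\<close>

lemma V_field_zero_limit:
  fixes N :: "nat \<Rightarrow> (real ^ 'n) measure"
  assumes N: "\<And>k. mass_on_ball (N k) R g" and mu: "mass_on_ball \<mu> R g"
    and weak: "weakly_converges_on_ball N \<mu>"
    and z: "\<And>k. norm (z k) \<le> S" "S < 1" "\<And>k. V_field g (N k) (z k) = 0" and lim: "z \<longlonglongrightarrow> l"
  shows "V_field g \<mu> l = 0"
proof (rule ccontr)
  assume "V_field g \<mu> l \<noteq> 0"
  define e where "e = V_field g \<mu> l"
  have e: "0 < norm e" using \<open>V_field g \<mu> l \<noteq> 0\<close> by (simp add: e_def)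
  interpret mu: mass_on_ball \<mu> R g by (rule mu)
  interpret N: mass_on_ball "N k" R g for k by (rule N)
  let ?F = "\<lambda>(x :: real ^ 'n) y. radial_field g (moebius x y)"
  have l: "norm l \<le> S" using tendsto_norm[OF lim] z(1) by (intro LIMSEQ_le_const2) auto
  have l1: "norm l < 1" using l z(2) by simp
  have z1: "norm (z k) < 1" for k using z(1)[of k] z(2) by simp
  \<comment> \<open>The integrand need not be bounded on the open ball. Composing it with the
    projection onto \<open>cball 0 R\<close> gives a bounded continuous test function that agrees
    with it almost everywhere for each of the measures.\<close>
  define \<psi> where "\<psi> y = ?F l (closest_point (cball 0 R) y) \<bullet> e" for y :: "real ^ 'n"
  have cp: "closest_point (cball 0 R) y \<in> cball 0 R" for y :: "real ^ 'n"
    using mu.R by (intro closest_point_in_set) auto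
  have cp_id: "closest_point (cball 0 R) y = y" if "norm y \<le> R" for y :: "real ^ 'n"
    using that by (intro closest_point_self) auto
  have cont: "continuous_on (cball 0 R) (\<lambda>y. ?F l y \<bullet> e)"
    using mu.R by (intro continuous_intros continuous_on_subset[OF mu.continuous_field[OF l1]]) auto
  have psi_cont: "continuous_on UNIV \<psi>"
    unfolding \<psi>_def
  proof (rule continuous_on_compose2[OF cont])
    show "continuous_on UNIV (closest_point (cball 0 R) :: real ^ 'n \<Rightarrow> _)"
      using mu.R by (intro continuous_on_closest_point) auto
  qed (use cp in auto)
  have "bounded ((\<lambda>y. ?F l y \<bullet> e) ` cball 0 R)"
    using cont by (intro compact_imp_bounded compact_continuous_image) auto
  then have "bounded (\<psi> ` ball 0 1)"
    by (rule bounded_subset) (use cp in \<open>auto simp: \<psi>_def\<close>)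
  then have "(\<lambda>k. \<integral>y. \<psi> y \<partial>(N k)) \<longlonglongrightarrow> (\<integral>y. \<psi> y \<partial>\<mu>)"
    using weak psi_cont continuous_on_subset[of UNIV \<psi> "ball 0 1"] unfolding weakly_converges_on_ball_def by blast
  moreover have psi_int: "(\<integral>y. \<psi> y \<partial>M) = V_field g M l \<bullet> e" if "mass_on_ball M R g" for M
  proof -
    interpret mass_on_ball M R g by (rule that)
    have "(\<integral>y. \<psi> y \<partial>M) = (\<integral>y. ?F l y \<bullet> e \<partial>M)"
    proof (rule integral_cong_AE)
      show "AE y in M. \<psi> y = ?F l y \<bullet> e"
        using supp by eventually_elim (simp add: \<psi>_def cp_id)
    qed (use continuous_on_subset[OF psi_cont] l1 in \<open>auto intro!: measurable_continuous continuous_intros continuous_field\<close>)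
    then show ?thesis by (simp add: V_field_inner[OF l1])
  qed
  ultimately have lim1: "(\<lambda>k. V_field g (N k) l \<bullet> e) \<longlonglongrightarrow> e \<bullet> e"
    by (simp add: psi_int[OF N] psi_int[OF mu] flip: e_def)
  \<comment> \<open>Testing with the constant 1 makes the masses converge, so eventually they stay
    below \<open>m\<close>.\<close>
  have "bounded ((\<lambda>_. 1 :: real) ` ball (0 :: real ^ 'n) 1)" by (rule bounded_subset[of "{1}"]) auto
  then have "(\<lambda>k. \<integral>y. 1 \<partial>(N k)) \<longlonglongrightarrow> (\<integral>y. (1::real) \<partial>\<mu>)"
    by (intro weak[unfolded weakly_converges_on_ball_def, rule_format]) auto
  then have mass_lim: "(\<lambda>k. measure (N k) (space (N k))) \<longlonglongrightarrow> measure \<mu> (space \<mu>)" by simp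
  define m where "m = measure \<mu> (space \<mu>) + 1"
  have m: "0 < m" using mu.mass by (simp add: m_def)
  have mass_le: "\<forall>\<^sub>F k in sequentially. measure (N k) (space (N k)) < m"
    using order_tendstoD(2)[OF mass_lim, of m] by (simp add: m_def)
  have "uniformly_continuous_on (cball 0 S \<times> cball 0 R) (\<lambda>(x, y). ?F x y)"
    using z(2) mu.R
    by (intro compact_uniformly_continuous compact_Times continuous_on_subset[OF continuous_on_field[OF mu.g]]) auto
  then have unif: "\<exists>d>0. \<forall>x y. norm x \<le> S \<longrightarrow> norm y \<le> R \<longrightarrow> dist x l < d \<longrightarrow> norm (?F l y - ?F x y) < \<epsilon>" if "0 < \<epsilon>" for \<epsilon>
  proof -
    obtain d where d: "0 < d" "\<And>p p'. p \<in> cball 0 S \<times> cball 0 R \<Longrightarrow> p' \<in> cball 0 S \<times> cball 0 R \<Longrightarrow> dist p' p < d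
      \<Longrightarrow> dist (case p' of (x, y) \<Rightarrow> ?F x y) (case p of (x, y) \<Rightarrow> ?F x y) < \<epsilon>"
      using \<open>uniformly_continuous_on _ _\<close> \<open>0 < \<epsilon>\<close> unfolding uniformly_continuous_on_def by metis
    have "norm (?F l y - ?F x y) < \<epsilon>" if "norm x \<le> S" "norm y \<le> R" "dist x l < d" for x y
      using d(2)[of "(x, y)" "(l, y)"] that l by (simp add: dist_norm dist_Pair_Pair dist_commute norm_minus_commute)
    then show ?thesis using d(1) by blast
  qed
  have "(\<lambda>k. V_field g (N k) l \<bullet> e) \<longlonglongrightarrow> 0"
  proof (rule tendstoI)
    fix \<epsilon> :: real assume \<epsilon>: "0 < \<epsilon>"
    define \<eta> where "\<eta> = \<epsilon> / (norm e * m)"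
    have \<eta>: "0 < \<eta>" using \<epsilon> e m by (simp add: \<eta>_def)
    obtain d where d: "0 < d" "\<And>x y. norm x \<le> S \<Longrightarrow> norm y \<le> R \<Longrightarrow> dist x l < d \<Longrightarrow> norm (?F l y - ?F x y) < \<eta>"
      using unif[OF \<eta>] by blast
    have "\<forall>\<^sub>F k in sequentially. dist (z k) l < d" using lim d(1) by (rule tendstoD)
    then show "\<forall>\<^sub>F k in sequentially. dist (V_field g (N k) l \<bullet> e) 0 < \<epsilon>"
      using mass_le
    proof eventually_elim
      fix k assume k: "dist (z k) l < d" "measure (N k) (space (N k)) < m"
      have "V_field g (N k) l \<bullet> e = V_field g (N k) l \<bullet> e - V_field g (N k) (z k) \<bullet> e" using z(3) by simp
      also have "\<dots> = (\<integral>y. ?F l y \<bullet> e - ?F (z k) y \<bullet> e \<partial>(N k))"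
        unfolding N.V_field_inner[OF l1] N.V_field_inner[OF z1]
        by (intro Bochner_Integration.integral_diff[symmetric] N.integrable_continuous continuous_intros N.continuous_field l1 z1)
      also have "norm \<dots> \<le> \<eta> * norm e * measure (N k) (space (N k))"
      proof (rule N.norm_integral_le)
        show "integrable (N k) (\<lambda>y. ?F l y \<bullet> e - ?F (z k) y \<bullet> e)"
          by (intro N.integrable_continuous continuous_intros N.continuous_field l1 z1)
        fix y :: "real ^ 'n" assume "norm y \<le> R"
        then have "norm (?F l y - ?F (z k) y) < \<eta>" using d(2) z(1) k(1) by blast
        then have "norm (?F l y - ?F (z k) y) * norm e \<le> \<eta> * norm e" by (simp add: mult_right_mono)
        then show "norm (?F l y \<bullet> e - ?F (z k) y \<bullet> e) \<le> \<eta> * norm e"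
          using Cauchy_Schwarz_ineq2[of "?F l y - ?F (z k) y" e] by (simp add: inner_diff_left)
      qed
      also have "\<dots> < \<eta> * norm e * m" using k(2) \<eta> e by (intro mult_strict_left_mono) auto
      also have "\<dots> = \<epsilon>" using e m by (simp add: \<eta>_def)
      finally show "dist (V_field g (N k) l \<bullet> e) 0 < \<epsilon>" by simp
    qed
  qed
  then have "e \<bullet> e = 0" using lim1 LIMSEQ_unique by blast
  then show False using e by simp
qed

text \<open>Outward pointing traps all zeros in one \<open>cball 0 S\<close>. A subsequence staying
  \<open>\<epsilon>\<close> away from \<open>x\<close> would have a further subsequence with a limit
  in that ball; this limit is a zero for \<open>\<mu>\<close>, hence equal to
  \<open>x\<close>.\<close>

lemma V_field_zeros_converge:
  fixes N :: "nat \<Rightarrow> (real ^ 'n) measure"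
  assumes N: "\<And>k. mass_on_ball (N k) R g" and mu: "mass_on_ball \<mu> R g"
    and gpos: "\<And>r. 0 < r \<Longrightarrow> r < 1 \<Longrightarrow> 0 < g r"
    and weak: "weakly_converges_on_ball N \<mu>"
    and z: "\<And>k. norm (z k) < 1" "\<And>k. V_field g (N k) (z k) = 0"
    and unique: "\<And>l. norm l < 1 \<Longrightarrow> V_field g \<mu> l = 0 \<Longrightarrow> l = x"
  shows "z \<longlonglongrightarrow> x"
proof (rule ccontr)
  assume "\<not> z \<longlonglongrightarrow> x"
  then obtain \<epsilon> where \<epsilon>: "0 < \<epsilon>" "\<not> (\<forall>\<^sub>F k in sequentially. dist (z k) x < \<epsilon>)"
    by (auto simp: tendsto_iff)
  have "0 \<le> R" "R < 1" using mass_on_ball.R[OF mu] by auto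
  then obtain S where S: "0 \<le> S" "S < 1"
    "\<And>x y :: real ^ 'n. S < norm x \<Longrightarrow> norm x < 1 \<Longrightarrow> norm y \<le> R \<Longrightarrow> 0 < moebius x y \<bullet> x"
    using moebius_outward by metis
  have zS: "norm (z k) \<le> S" for k
    using mass_on_ball.V_field_nonzero_if_outward[OF N gpos z(1)] S(3) z by (meson not_le)
  have "infinite {k. \<not> dist (z k) x < \<epsilon>}"
    using \<epsilon>(2) by (simp add: eventually_cofinite flip: cofinite_eq_sequentially)
  then obtain r :: "nat \<Rightarrow> nat" where r: "strict_mono r" "\<And>k. \<not> dist (z (r k)) x < \<epsilon>"
    using infinite_enumerate by blast
  have "seq_compact (cball (0 :: real ^ 'n) S)" by (simp add: compact_imp_seq_compact)
  then obtain l r' where l: "strict_mono r'" "((z \<circ> r) \<circ> r') \<longlonglongrightarrow> l"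
    using zS by (auto elim!: seq_compactE[where f = "z \<circ> r"])
  let ?q = "r \<circ> r'"
  have q: "strict_mono ?q" using r(1) l(1) by (rule strict_mono_o)
  have lim: "(\<lambda>k. z (?q k)) \<longlonglongrightarrow> l" using l(2) by (simp add: o_def)
  have "weakly_converges_on_ball (\<lambda>k. N (?q k)) \<mu>"
    using weak LIMSEQ_subseq_LIMSEQ[OF _ q] unfolding weakly_converges_on_ball_def by (auto simp: o_def)
  then have "V_field g \<mu> l = 0"
    by (intro V_field_zero_limit[where N = "\<lambda>k. N (?q k)" and z = "\<lambda>k. z (?q k)", OF N mu _ zS S(2) z(2) lim])
  moreover have "norm l \<le> S" using tendsto_norm[OF lim] zS by (intro LIMSEQ_le_const2) auto
  ultimately have "l = x" using unique S(2) by simp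
  then have "\<forall>\<^sub>F k in sequentially. dist (z (?q k)) x < \<epsilon>" using lim \<epsilon>(1) tendstoD by blast
  then show False using r(2) by (auto simp: eventually_sequentially)
qed

section \<open>Assembly of existence, uniqueness and continuity\<close>

lemma mass_on_ballI:
  assumes M: "borel_measure_on_ball M" "supported_in M K" "0 < emeasure M (ball 0 1)" "emeasure M (ball 0 1) < \<infinity>"
    and K: "compact K" "K \<subseteq> cball 0 R" and R: "0 \<le> R" "R < 1"
    and g: "continuous_on {0..<1} g" "g 0 = 0"
  shows "mass_on_ball M R g"
proof -
  have sets: "sets M = sets (restrict_space borel (ball 0 1))"
    using M by (simp add: borel_measure_on_ball_def)
  have space: "space M = ball 0 1"
    using sets_eq_imp_space_eq[OF sets] by (simp add: space_restrict_space)
  interpret finite_measure M using M by (intro finite_measureI) (simp add: space)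
  show ?thesis
  proof
    \<comment> \<open>Measure 0 gives a null set only once the set is known to be
      measurable.\<close>
    have "ball 0 1 - K \<in> sets M"
      unfolding sets sets_restrict_space using K(1)
      by (intro image_eqI[of _ _ "- K"]) (auto intro!: borel_closed compact_imp_closed borel_comp)
    then show "AE y in M. norm y \<le> R"
      using M(2) K(2) by (intro AE_I[of _ _ "ball 0 1 - K"]) (auto simp: space supported_in_def)
    show "0 < measure M (space M)" using M by (simp add: measure_def space enn2real_positive_iff less_top)
  qed (use M R g in auto)
qed

lemma center_of_mass_eqI:
  assumes "\<exists>!x. x \<in> ball 0 1 \<and> V_field g \<mu> x = 0"
  shows "norm (center_of_mass g \<mu>) < 1" "V_field g \<mu> (center_of_mass g \<mu>) = 0"
  using theI'[OF assms] by (simp_all add: center_of_mass_def)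

theorem theorem1:
  fixes g :: "real \<Rightarrow> real" and \<mu> :: "(real ^ 'n) measure"
  assumes g_cont: "continuous_on {0..<1} g"
    and g_zero: "g 0 = 0"
    and mu_borel: "borel_measure_on_ball \<mu>"
    and mu_supp: "\<exists>K. compact K \<and> K \<subseteq> ball 0 1 \<and> supported_in \<mu> K"
    and mu_mass: "0 < emeasure \<mu> (ball 0 1)" "emeasure \<mu> (ball 0 1) < \<infinity>"
  shows
    "(filterlim (\<lambda>\<rho>. integral {0..\<rho>} (\<lambda>r. g r / (1 - r\<^sup>2))) at_top (at_left 1) \<longrightarrow>
        (\<exists>x\<in>ball 0 1. V_field g \<mu> x = 0)) \<and>
     (strict_mono_on {0..<1} g \<or>
      (mono_on {0..<1} g \<and> (\<forall>r. 0 < r \<and> r < 1 \<longrightarrow> g r > 0) \<and>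
       not_supported_in_geodesic \<mu>) \<longrightarrow>
        (\<exists>!x. x \<in> ball 0 1 \<and> V_field g \<mu> x = 0)) \<and>
     (\<forall>M :: nat \<Rightarrow> (real ^ 'n) measure.
        (\<forall>k. borel_measure_on_ball (M k)) \<and>
        (\<exists>K. compact K \<and> K \<subseteq> ball 0 1 \<and> (\<forall>k. supported_in (M k) K)) \<and>
        (\<forall>k. 0 < emeasure (M k) (ball 0 1) \<and> emeasure (M k) (ball 0 1) < \<infinity>) \<and>
        weakly_converges_on_ball M \<mu> \<and>
        (strict_mono_on {0..<1} g \<or>
         (mono_on {0..<1} g \<and> (\<forall>r. 0 < r \<and> r < 1 \<longrightarrow> g r > 0) \<and>
          not_supported_in_geodesic \<mu> \<and> (\<forall>k. not_supported_in_geodesic (M k)))) \<longrightarrow>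
        (\<lambda>k. center_of_mass g (M k)) \<longlonglongrightarrow> center_of_mass g \<mu>)"
proof (intro conjI impI allI)
  obtain K0 where K0: "compact K0" "K0 \<subseteq> ball 0 1" "supported_in \<mu> K0" using mu_supp by blast
  have potential: "radial_potential g = (\<lambda>\<rho>. integral {0..\<rho>} (\<lambda>r. g r / (1 - r\<^sup>2)))"
    by (simp add: radial_potential_def[abs_def])
  have mu: "mass_on_ball \<mu> R g" if "K0 \<subseteq> cball 0 R" "0 \<le> R" "R < 1" for R
    using mass_on_ballI[OF mu_borel K0(3) mu_mass K0(1) that g_cont g_zero] .
  obtain R0 where R0: "0 \<le> R0" "R0 < 1" "K0 \<subseteq> cball 0 R0"
    using compact_subset_ball_imp_cball K0 by blast
  show "\<exists>x\<in>ball 0 1. V_field g \<mu> x = 0"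
    if "filterlim (\<lambda>\<rho>. integral {0..\<rho>} (\<lambda>r. g r / (1 - r\<^sup>2))) at_top (at_left 1)"
    using mass_on_ball.V_field_zero_exists[OF mu[OF R0(3,1,2)]] that by (simp add: potential)
  \<comment> \<open>Strict growth from \<open>g 0 = 0\<close> gives positivity, so both alternatives
    share these two properties.\<close>
  have mono_pos: "mono_on {0..<1} g \<and> (\<forall>r. 0 < r \<and> r < 1 \<longrightarrow> 0 < g r)" if "strict_mono_on {0..<1} g"
    using strict_mono_onD[OF that, of 0] g_zero strict_mono_on_imp_mono_on[OF that] by simp
  \<comment> \<open>For arbitrary \<open>M\<close>, because it is applied to \<open>\<mu>\<close>
    and to every \<open>M k\<close>.\<close>
  have unique: "\<exists>!x. x \<in> ball 0 1 \<and> V_field g M x = 0"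
    if M: "mass_on_ball M R g"
      and *: "strict_mono_on {0..<1} g \<or> (mono_on {0..<1} g \<and> (\<forall>r. 0 < r \<and> r < 1 \<longrightarrow> g r > 0) \<and>
        not_supported_in_geodesic M)" for M R
  proof -
    have g': "mono_on {0..<1} g" "\<And>r. 0 < r \<Longrightarrow> r < 1 \<Longrightarrow> 0 < g r" using * mono_pos by auto
    have "\<exists>x\<in>ball 0 1. V_field g M x = 0"
      by (intro mass_on_ball.V_field_zero_exists[OF M] radial_potential_at_top[OF g_cont g'])
    moreover have "x = z" if "norm x < 1" "V_field g M x = 0" "norm z < 1" "V_field g M z = 0" for x z
      using mass_on_ball.V_field_zero_unique[OF M g'(1) _ that] * by blast
    ultimately show ?thesis by auto
  qed
  show "\<exists>!x. x \<in> ball 0 1 \<and> V_field g \<mu> x = 0"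
    if "strict_mono_on {0..<1} g \<or> (mono_on {0..<1} g \<and> (\<forall>r. 0 < r \<and> r < 1 \<longrightarrow> g r > 0) \<and>
      not_supported_in_geodesic \<mu>)"
    using unique[OF mu[OF R0(3,1,2)] that] .
  fix M :: "nat \<Rightarrow> (real ^ 'n) measure"
  assume A: "(\<forall>k. borel_measure_on_ball (M k)) \<and>
        (\<exists>K. compact K \<and> K \<subseteq> ball 0 1 \<and> (\<forall>k. supported_in (M k) K)) \<and>
        (\<forall>k. 0 < emeasure (M k) (ball 0 1) \<and> emeasure (M k) (ball 0 1) < \<infinity>) \<and>
        weakly_converges_on_ball M \<mu> \<and>
        (strict_mono_on {0..<1} g \<or>
         (mono_on {0..<1} g \<and> (\<forall>r. 0 < r \<and> r < 1 \<longrightarrow> g r > 0) \<and>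
          not_supported_in_geodesic \<mu> \<and> (\<forall>k. not_supported_in_geodesic (M k))))"
  obtain K where K: "compact K" "K \<subseteq> ball 0 1" "\<And>k. supported_in (M k) K" using A by blast
  \<comment> \<open>The limit argument needs one radius for \<open>\<mu>\<close> and all
    \<open>M k\<close>, hence the union of both compact sets.\<close>
  obtain R where R: "0 \<le> R" "R < 1" "K0 \<union> K \<subseteq> cball 0 R"
    using compact_subset_ball_imp_cball[of "K0 \<union> K"] K K0 by (metis Un_least compact_Un)
  have KR: "K0 \<subseteq> cball 0 R" "K \<subseteq> cball 0 R" using R(3) by auto
  have Mk: "mass_on_ball (M k) R g" for k
    using A K KR R g_cont g_zero by (intro mass_on_ballI[of _ K]) auto
  have mu': "mass_on_ball \<mu> R g" using mu KR R by blast
  have uM: "\<exists>!x. x \<in> ball 0 1 \<and> V_field g (M k) x = 0" for k using A by (intro unique[OF Mk]) blast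
  have u: "\<exists>!x. x \<in> ball 0 1 \<and> V_field g \<mu> x = 0" using A by (intro unique[OF mu']) blast
  show "(\<lambda>k. center_of_mass g (M k)) \<longlonglongrightarrow> center_of_mass g \<mu>"
  proof (rule V_field_zeros_converge[OF Mk mu'])
    show "0 < g r" if "0 < r" "r < 1" for r using A mono_pos that by blast
    show "weakly_converges_on_ball M \<mu>" using A by blast
    show "norm (center_of_mass g (M k)) < 1" "V_field g (M k) (center_of_mass g (M k)) = 0" for k
      using center_of_mass_eqI[OF uM] by auto
    show "l = center_of_mass g \<mu>" if "norm l < 1" "V_field g \<mu> l = 0" for l
      using u that center_of_mass_eqI[OF u] by auto
  qed
qed

end
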